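(* Let $n,m\in\mathbb{N}$, $t_0\in\mathbb{N}$, and let $\{W(t)\}$ be a sequence of random $n\times n$ matrices adapted to a filtration $\{\mathcal{F}(t)\}$. Assume: (1) for all $t\ge t_0$, $W(t)$ is row-stochastic almost surely, and for every $t>t_0$, $\mathbb{E}[W(t)\mid\mathcal{F}(t-1)]$ is column-stochastic almost surely; (2) for a fixed $\gamma\in(0,1)$ and all $t\ge t_0$: every node of $\mathcal{G}(W(t))$ has a self-loop almost surely, and there is an integer $B>0$, independent of $t$, such that the random graph $([n],\mathcal{E}_B(t))$ with $\mathcal{E}_B(t)=\bigcup_{\tau=tB+1}^{(t+1)B}\mathcal{E}(\mathbb{E}[W(\tau)\mid\mathcal{F}(tB)])$ has a spanning rooted tree almost surely; (3) $\{\alpha(t)\}_{t\ge t_0}$ is a deterministic sequence with $0<\alpha(t)\le Kt^{-\beta}$ for some $K,\beta>0$ and all $t\ge t_0$, $\lim_{t\to\infty}\frac{\alpha(t)}{\alpha(t+1)}=1$, $\sum_{t=t_0}^\infty\alpha(t)=\infty$, and $\sum_{t=t_0}^\infty\alpha^2(t)<\infty$. Let $\mathbf{x}(t_0)\in(\mathbb{R}^m)^n$ be a (deterministic) initial condition, let $\{\mathbf{u}(t)\}_{t\ge t_0}$ be a sequence of random vectors in $(\mathbb{R}^m)^n$, and let $\mathbf{x}(t+1)=W(t+1)\mathbf{x}(t)+\mathbf{u}(t)$ for $t\ge t_0$. If, for some $q>0$, $d(\mathbf{u}(t))<q\,\alpha(t)$ almost surely for all $t\ge t_0$, then there is $\hat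 M>0$ such that $$\frac{\mathbb{E}[d^2(\mathbf{x}(t))]}{\alpha^2(t)}\le\hat M\qquad\text{for all }t\ge t_0.$$
   Context: $[n]=\{1,\dots,n\}$. A filtration is an increasing sequence of sigma-algebras $\mathcal{F}(0)\subseteq\mathcal{F}(1)\subseteq\cdots$; adapted means $W(t)$ is $\mathcal{F}(t)$-measurable for every $t$. A non-negative matrix $A$ is row-stochastic if each row sums to 1 and column-stochastic if each column sums to 1. For an $n\times n$ matrix $A=[a_{ij}]$, $\mathcal{G}(A)=([n],\mathcal{E}(A))$ is the directed graph with edge set $\mathcal{E}(A)=\{(j,i): i,j\in[n],\ a_{ij}>\gamma\}$. A directed graph on $[n]$ has a spanning rooted tree if there is a vertex $r$ from which there is a directed path to every other vertex. An element $\mathbf{x}\in(\mathbb{R}^m)^n$ is a vector of $n$ entries $\mathbf{x}_i\in\mathbb{R}^m$; for an $n\times n$ matrix $A$, $[A\mathbf{x}]_i=\sum_{j=1}^n a_{ij}\mathbf{x}_j$. $\|\cdot\|$ is the $\ell_\infty$ norm on $\mathbb{R}^m$ and $d(\mathbf{x})=\max_{i,j\in[n]}\|\mathbf{x}_i-\mathbf{x}_j\|$; $d^2(\mathbf{x})$ means $(d(\mathbf{x}))^2$. *)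

theory Defs
  imports "HOL-Probability.Probability"
begin

definition row_stochastic :: "real^'n^'n \<Rightarrow> bool" where
  "row_stochastic A \<longleftrightarrow> (\<forall>i j. 0 \<le> A $ i $ j) \<and> (\<forall>i. (\<Sum>j\<in>UNIV. A $ i $ j) = 1)"

definition column_stochastic :: "real^'n^'n \<Rightarrow> bool" where
  "column_stochastic A \<longleftrightarrow> (\<forall>i j. 0 \<le> A $ i $ j) \<and> (\<forall>j. (\<Sum>i\<in>UNIV. A $ i $ j) = 1)"

text \<open>The entry in row \<open>i\<close> and column \<open>j\<close> gives the edge from \<open>j\<close> to \<open>i\<close>.\<close>

definition edges :: "real \<Rightarrow> real^'n^'n \<Rightarrow> ('n \<times> 'n) set" where
  "edges \<gamma> A = {(j, i). A $ i $ j > \<gamma>}"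

definition has_spanning_rooted_tree :: "('v \<times> 'v) set \<Rightarrow> bool" where
  "has_spanning_rooted_tree E \<longleftrightarrow> (\<exists>r. \<forall>v. v \<noteq> r \<longrightarrow> (r, v) \<in> E\<^sup>+)"

definition cond_exp_matrix ::
  "'w measure \<Rightarrow> 'w measure \<Rightarrow> ('w \<Rightarrow> real^'n^'n) \<Rightarrow> 'w \<Rightarrow> real^'n^'n" where
  "cond_exp_matrix M G A \<omega> = (\<chi> i j. real_cond_exp M G (\<lambda>\<omega>'. A \<omega>' $ i $ j) \<omega>)"

text \<open>
  An \<open>n\<close>-tuple of vectors in \<open>\<real>\<^sup>m\<close> has type \<open>real^'m^'n\<close>, its \<open>i\<close>-th entry being \<open>x $ i\<close>. With this
  representation, the action of an \<open>n \<times> n\<close> matrix on tuples is the matrix product: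
\<close>

lemma matrix_mult_tuple_nth:
  fixes A :: "real^'n^'n" and x :: "real^'m^'n"
  shows "(A ** x) $ i = (\<Sum>j\<in>UNIV. A $ i $ j *\<^sub>R x $ j)"
  by (simp add: vec_eq_iff matrix_matrix_mult_def)

definition spread :: "real^'m^'n \<Rightarrow> real" where
  "spread x = Max {infnorm (x $ i - x $ j) | i j. True}"

end

theory Submission
  imports Defs
begin

text \<open>
  Unrolling the recursion writes \<open>x(t)\<close> as a sum of transition matrices applied to the inputs. The
  spread of \<open>\<Phi> y\<close> is at most the spread of \<open>y\<close> times the sum of the oscillations of the columns
  of \<open>\<Phi>\<close>; since this bound is uniform in \<open>y\<close>, the inputs \<open>u(t)\<close> may depend on the future of \<open>W\<close>.

  A column \<open>Z\<close> of \<open>\<Phi>\<close> is an adapted averaging process. As the conditional means of \<open>W\<close> are column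
  stochastic, the expected squared deviation of \<open>Z\<close> from a fixed centre decreases in every step by
  at least \<open>\<gamma> / 2\<close> times the expectation of the energy \<open>\<Sum>\<^sub>i\<^sub>j w\<^sub>i\<^sub>j (Z\<^sub>j - Z\<^sub>i)\<^sup>2\<close>. At the start of a block
  some cut separates the values of \<open>Z\<close> by a gap of at least \<open>1 / n\<close> of their oscillation, and
  pathwise the energy of the block is bounded below by the squared oscillation times the weight that
  crosses this cut. A spanning tree has an edge across every cut, so the conditional expectation
  of that weight is at least \<open>\<gamma>\<close>, and the variance contracts geometrically from block to block.

  Finally a weighted Cauchy-Schwarz inequality bounds the second moment of the spread by the square
  of the convolution of \<open>\<alpha>\<close> with a geometric sequence, which is \<open>O(\<alpha>)\<close> as \<open>\<alpha>(t) / \<alpha>(t+1) \<longlonglongrightarrow> 1\<close>.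
\<close>

section \<open>Averaging along a sequence of row-stochastic matrices\<close>

definition osc :: "('n::finite \<Rightarrow> real) \<Rightarrow> real" where
  "osc z = Max (range z) - Min (range z)"

lemma diff_le_osc: "z i - z j \<le> osc z"
proof -
  have "z i \<le> Max (range z)" "Min (range z) \<le> z j" by auto
  then show ?thesis unfolding osc_def by linarith
qed

lemma osc_nonneg: "0 \<le> osc z"
  using diff_le_osc[of z undefined undefined] by simp

lemma osc_attained: "\<exists>i j. osc z = z i - z j"
proof -
  have "Max (range z) \<in> range z" "Min (range z) \<in> range z" by (auto intro: Max_in Min_in)
  then show ?thesis unfolding osc_def by (metis rangeE)
qed

lemma osc_leI: "(\<And>i j. z i - z j \<le> d) \<Longrightarrow> osc z \<le> d"
  using osc_attained[of z] by auto

lemma borel_measurable_osc: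
  assumes "\<And>i. (\<lambda>\<omega>. z \<omega> i) \<in> borel_measurable N"
  shows "(\<lambda>\<omega>. osc (z \<omega>)) \<in> borel_measurable N"
proof -
  have "(\<lambda>\<omega>. Max ((\<lambda>i. z \<omega> i) ` UNIV)) \<in> borel_measurable N"
       "(\<lambda>\<omega>. Min ((\<lambda>i. z \<omega> i) ` UNIV)) \<in> borel_measurable N"
    using assms by (auto intro!: borel_measurable_Max borel_measurable_Min)
  then show ?thesis unfolding osc_def by simp
qed

lemma row_stochastic_average_mono:
  fixes A :: "real^'n^'n"
  assumes "row_stochastic A"
  shows "(\<And>j. y j \<le> b) \<Longrightarrow> (\<Sum>j\<in>UNIV. A $ i $ j * y j) \<le> b"
    and "(\<And>j. a \<le> y j) \<Longrightarrow> a \<le> (\<Sum>j\<in>UNIV. A $ i $ j * y j)"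
proof -
  have nn: "0 \<le> A $ i $ j" for j using assms by (simp add: row_stochastic_def)
  have one: "(\<Sum>j\<in>UNIV. A $ i $ j * c) = c" for c
    using assms by (simp add: row_stochastic_def flip: sum_distrib_right)
  show "(\<Sum>j\<in>UNIV. A $ i $ j * y j) \<le> b" if "\<And>j. y j \<le> b"
    using sum_mono[of UNIV "\<lambda>j. A $ i $ j * y j" "\<lambda>j. A $ i $ j * b"] that nn
    by (simp add: one mult_left_mono)
  show "a \<le> (\<Sum>j\<in>UNIV. A $ i $ j * y j)" if "\<And>j. a \<le> y j"
    using sum_mono[of UNIV "\<lambda>j. A $ i $ j * a" "\<lambda>j. A $ i $ j * y j"] that nn
    by (simp add: one mult_left_mono)
qed

lemma osc_average_le:
  fixes A :: "real^'n^'n"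
  assumes "row_stochastic A"
  shows "osc (\<lambda>i. \<Sum>j\<in>UNIV. A $ i $ j * y j) \<le> osc y"
proof (rule osc_leI)
  fix i k
  have "(\<Sum>j\<in>UNIV. A $ i $ j * y j) \<le> Max (range y)"
    using assms by (rule row_stochastic_average_mono) simp
  moreover have "Min (range y) \<le> (\<Sum>j\<in>UNIV. A $ k $ j * y j)"
    using assms by (rule row_stochastic_average_mono) simp
  ultimately show "(\<Sum>j\<in>UNIV. A $ i $ j * y j) - (\<Sum>j\<in>UNIV. A $ k $ j * y j) \<le> osc y"
    by (simp add: osc_def)
qed

section \<open>Squared deviation, energy and cut weight of one averaging step\<close>

definition sq_dev :: "real \<Rightarrow> ('n::finite \<Rightarrow> real) \<Rightarrow> real" where
  "sq_dev c z = (\<Sum>i\<in>UNIV. (z i - c)\<^sup>2)"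

definition mean :: "('n::finite \<Rightarrow> real) \<Rightarrow> real" where
  "mean z = (\<Sum>i\<in>UNIV. z i) / real CARD('n)"

text \<open>The Dirichlet form of the weights \<open>A\<close>, which need not be symmetric.\<close>

definition energy :: "real^'n^'n \<Rightarrow> ('n \<Rightarrow> real) \<Rightarrow> real" where
  "energy A z = (\<Sum>i\<in>UNIV. \<Sum>j\<in>UNIV. A $ i $ j * (z j - z i)\<^sup>2)"

text \<open>Crossings in both directions count, so \<open>S\<close> and its complement have the same
  weight. Hence one estimate serves for the values in \<open>S\<close> and, after a change of sign,
  for those outside.\<close>

definition cut_weight :: "'n set \<Rightarrow> real^'n^'n \<Rightarrow> real" where
  "cut_weight S A = (\<Sum>i\<in>UNIV. \<Sum>j\<in>UNIV. if (i \<in> S) \<noteq> (j \<in> S) then A $ i $ j else 0)"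

text \<open>Expanding around the mean, the cross term vanishes and only a multiple of
  \<open>(mean z - c)^2\<close> is added.\<close>

lemma sq_dev_mean_le:
  fixes z :: "'n::finite \<Rightarrow> real"
  shows "sq_dev (mean z) z \<le> sq_dev c z"
proof -
  have "sq_dev c z = (\<Sum>i\<in>UNIV. (z i - mean z)\<^sup>2 + 2 * (mean z - c) * (z i - mean z) + (mean z - c)\<^sup>2)"
    unfolding sq_dev_def by (intro sum.cong) (auto simp: power2_eq_square algebra_simps)
  also have "\<dots> = sq_dev (mean z) z + 2 * (mean z - c) * ((\<Sum>i\<in>UNIV. z i) - real CARD('n) * mean z)
      + real CARD('n) * (mean z - c)\<^sup>2"
    by (simp add: sum.distrib sq_dev_def sum_subtractf flip: sum_distrib_left)
  also have "(\<Sum>i\<in>UNIV. z i) - real CARD('n) * mean z = 0"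
    by (simp add: mean_def)
  finally show ?thesis by simp
qed

lemma mean_bounds:
  fixes z :: "'n::finite \<Rightarrow> real"
  shows "Min (range z) \<le> mean z" "mean z \<le> Max (range z)"
proof -
  have "(\<Sum>i\<in>(UNIV::'n set). z i) \<le> real CARD('n) * Max (range z)"
    by (rule sum_bounded_above) simp
  then show "mean z \<le> Max (range z)" by (simp add: mean_def field_simps)
  have "real CARD('n) * Min (range z) \<le> (\<Sum>i\<in>(UNIV::'n set). z i)"
    by (rule sum_bounded_below) simp
  then show "Min (range z) \<le> mean z" by (simp add: mean_def field_simps)
qed

lemma sq_dev_mean_le_osc:
  fixes z :: "'n::finite \<Rightarrow> real"
  shows "sq_dev (mean z) z \<le> real CARD('n) * (osc z)\<^sup>2"
  unfolding sq_dev_def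
proof (rule sum_bounded_above)
  fix i
  have "z i \<le> Max (range z)" "Min (range z) \<le> z i" by auto
  then have "\<bar>z i - mean z\<bar> \<le> osc z"
    using mean_bounds[of z] unfolding osc_def by linarith
  then show "(z i - mean z)\<^sup>2 \<le> (osc z)\<^sup>2" by (rule power2_le_iff_abs_le[THEN iffD2, rotated]) (rule osc_nonneg)
qed

lemma osc_le_sq_dev: "(osc z)\<^sup>2 \<le> 4 * sq_dev c z"
proof -
  obtain i j where ij: "osc z = z i - z j" using osc_attained by blast
  have le: "(z k - c)\<^sup>2 \<le> sq_dev c z" for k
    unfolding sq_dev_def by (rule member_le_sum) auto
  \<comment> \<open>With \<open>p = z i - c\<close> and \<open>r = z j - c\<close> this is
    \<open>(p - r)^2 \<le> 2 * p^2 + 2 * r^2\<close>, that is,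
    \<open>0 \<le> (p + r)^2\<close>.\<close>
  have "(osc z)\<^sup>2 \<le> 2 * (z i - c)\<^sup>2 + 2 * (z j - c)\<^sup>2"
    using zero_le_power2[of "z i - c + (z j - c)"] unfolding ij
    by (simp add: power2_eq_square algebra_simps)
  then show ?thesis using le[of i] le[of j] by simp
qed

text \<open>Jensen's inequality for the square with a quantitative defect. The defect is the
  weighted variance \<open>v\<close>. The self-loop gives
  \<open>\<gamma> * (m - y i)^2 \<le> v\<close>, so \<open>v\<close> dominates
  \<open>\<gamma> / 2\<close> times the second moment of \<open>y\<close> about \<open>y i\<close>,
  which is \<open>v + (m - y i)^2\<close>.\<close>

lemma row_variance_bound:
  fixes a y :: "'n::finite \<Rightarrow> real"
  assumes nn: "\<And>j. 0 \<le> a j" and one: "(\<Sum>j\<in>UNIV. a j) = 1" and "\<gamma> \<le> a i" "0 \<le> \<gamma>" "\<gamma> \<le> 1"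
  shows "((\<Sum>j\<in>UNIV. a j * y j) - c)\<^sup>2
    \<le> (\<Sum>j\<in>UNIV. a j * (y j - c)\<^sup>2) - \<gamma> / 2 * (\<Sum>j\<in>UNIV. a j * (y j - y i)\<^sup>2)"
proof -
  define m where "m = (\<Sum>j\<in>UNIV. a j * y j)"
  define v where "v = (\<Sum>j\<in>UNIV. a j * (y j - m)\<^sup>2)"
  \<comment> \<open>The decomposition of a second moment into variance and squared bias; it is used
    for \<open>b = c\<close> and for \<open>b = y i\<close>.\<close>
  have dec: "(\<Sum>j\<in>UNIV. a j * (y j - b)\<^sup>2) = v + (m - b)\<^sup>2" for b
  proof -
    have "(\<Sum>j\<in>UNIV. a j * (y j - b)\<^sup>2)
      = (\<Sum>j\<in>UNIV. a j * (y j - m)\<^sup>2 + 2 * (m - b) * (a j * y j - m * a j) + (m - b)\<^sup>2 * a j)"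
      by (intro sum.cong) (auto simp: power2_eq_square algebra_simps)
    also have "\<dots> = v + 2 * (m - b) * (m - m * 1) + (m - b)\<^sup>2 * 1"
      by (simp only: sum.distrib sum_subtractf one v_def m_def flip: sum_distrib_left)
    finally show ?thesis by simp
  qed
  have "\<gamma> * (m - y i)\<^sup>2 \<le> a i * (y i - m)\<^sup>2"
    using assms by (simp add: mult_right_mono power2_commute)
  also have "\<dots> \<le> v" unfolding v_def by (rule member_le_sum) (auto simp: nn)
  finally have 1: "\<gamma> * (m - y i)\<^sup>2 \<le> v" .
  have "0 \<le> v" unfolding v_def by (intro sum_nonneg) (simp add: nn)
  then have 2: "\<gamma> * v \<le> v" using assms by (simp add: mult_left_le_one_le)
  show ?thesis unfolding dec m_def[symmetric] using 1 2 by (simp add: algebra_simps)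
qed

text \<open>The row bounds are added up. The double sum is swapped to have the column sums of
  \<open>A\<close> inside, since these become 1 under the conditional expectation.\<close>

lemma sq_dev_average_le:
  fixes A :: "real^'n^'n"
  assumes "row_stochastic A" "\<And>i. \<gamma> \<le> A $ i $ i" "0 \<le> \<gamma>" "\<gamma> \<le> 1"
  shows "sq_dev c (\<lambda>i. \<Sum>j\<in>UNIV. A $ i $ j * y j)
    \<le> (\<Sum>j\<in>UNIV. \<Sum>i\<in>UNIV. A $ i $ j * (y j - c)\<^sup>2) - \<gamma> / 2 * energy A y"
proof -
  have "sq_dev c (\<lambda>i. \<Sum>j\<in>UNIV. A $ i $ j * y j)
    \<le> (\<Sum>i\<in>UNIV. (\<Sum>j\<in>UNIV. A $ i $ j * (y j - c)\<^sup>2) - \<gamma> / 2 * (\<Sum>j\<in>UNIV. A $ i $ j * (y j - y i)\<^sup>2))"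
    unfolding sq_dev_def
    by (intro sum_mono row_variance_bound) (use assms in \<open>auto simp: row_stochastic_def\<close>)
  also have "\<dots> = (\<Sum>i\<in>UNIV. \<Sum>j\<in>UNIV. A $ i $ j * (y j - c)\<^sup>2) - \<gamma> / 2 * energy A y"
    by (simp add: sum_subtractf energy_def sum_distrib_left)
  also have "(\<Sum>i\<in>UNIV. \<Sum>j\<in>UNIV. A $ i $ j * (y j - c)\<^sup>2) = (\<Sum>j\<in>UNIV. \<Sum>i\<in>UNIV. A $ i $ j * (y j - c)\<^sup>2)"
    by (rule sum.swap)
  finally show ?thesis .
qed

lemma energy_nonneg: "row_stochastic A \<Longrightarrow> 0 \<le> energy A z"
  unfolding energy_def row_stochastic_def by (intro sum_nonneg) auto

lemma cut_weight_nonneg: "row_stochastic A \<Longrightarrow> 0 \<le> cut_weight S A"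
  unfolding cut_weight_def row_stochastic_def by (intro sum_nonneg) auto

lemma cut_weight_Compl: "cut_weight (- S) A = cut_weight S A"
  unfolding cut_weight_def by (intro sum.cong) auto

lemma cut_weight_le:
  fixes A :: "real^'n^'n"
  assumes "row_stochastic A"
  shows "cut_weight S A \<le> real CARD('n)"
proof -
  have "cut_weight S A \<le> (\<Sum>i\<in>UNIV. \<Sum>j\<in>UNIV. A $ i $ j)"
    unfolding cut_weight_def using assms by (intro sum_mono) (auto simp: row_stochastic_def)
  also have "\<dots> = real CARD('n)" using assms by (simp add: row_stochastic_def)
  finally show ?thesis .
qed

lemma row_cut_weight_le:
  fixes A :: "real^'n^'n"
  assumes "row_stochastic A" "i \<in> S"
  shows "(\<Sum>j\<in>UNIV. if j \<in> S then 0 else A $ i $ j) \<le> cut_weight S A"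
proof -
  have "(\<Sum>j\<in>UNIV. if j \<in> S then 0 else A $ i $ j)
      = (\<Sum>j\<in>UNIV. if (i \<in> S) \<noteq> (j \<in> S) then A $ i $ j else 0)"
    using assms by (intro sum.cong) auto
  also have "\<dots> \<le> cut_weight S A" unfolding cut_weight_def
    by (rule member_le_sum[of i UNIV "\<lambda>i. \<Sum>j\<in>UNIV. if (i \<in> S) \<noteq> (j \<in> S) then A $ i $ j else 0"])
      (use assms in \<open>auto simp: row_stochastic_def intro!: sum_nonneg\<close>)
  finally show ?thesis .
qed

section \<open>Energy spent across a cut during a block\<close>

lemma cut_lower_step:
  fixes A :: "real^'n^'n"
  assumes A: "row_stochastic A" and i: "i \<in> S" and lo: "\<And>j. j \<in> S \<Longrightarrow> b \<le> y j"
    and d: "\<And>j k. y k - y j \<le> d" "0 \<le> d"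
  shows "b - d * cut_weight S A \<le> (\<Sum>j\<in>UNIV. A $ i $ j * y j)"
proof -
  have nn: "0 \<le> A $ i $ j" for j using A by (simp add: row_stochastic_def)
  have "d * (\<Sum>j\<in>UNIV. if j \<in> S then 0 else A $ i $ j) \<le> d * cut_weight S A"
    using row_cut_weight_le[OF A i] d by (simp add: mult_left_mono)
  then have "b - d * cut_weight S A \<le> b * (\<Sum>j\<in>UNIV. A $ i $ j) - d * (\<Sum>j\<in>UNIV. if j \<in> S then 0 else A $ i $ j)"
    using A by (simp add: row_stochastic_def)
  also have "\<dots> = (\<Sum>j\<in>UNIV. A $ i $ j * (b - (if j \<in> S then 0 else d)))"
    by (simp add: sum_distrib_left algebra_simps flip: sum_subtractf) (intro sum.cong, auto)
  also have "\<dots> \<le> (\<Sum>j\<in>UNIV. A $ i $ j * y j)"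
  proof (intro sum_mono mult_left_mono nn)
    \<comment> \<open>Values outside \<open>S\<close> are at least \<open>y i - d\<close>, and
      \<open>y i\<close> is at least \<open>b\<close> because \<open>i\<close> lies in
      \<open>S\<close>.\<close>
    fix j show "b - (if j \<in> S then 0 else d) \<le> y j"
      using lo[of j] lo[OF i] d(1)[of i j] by auto
  qed
  finally show ?thesis .
qed

text \<open>Every crossing pair, in either direction, contributes at least \<open>h^2\<close> times
  its weight; the other terms of the energy are non-negative.\<close>

lemma cut_energy_le:
  fixes A :: "real^'n^'n"
  assumes "row_stochastic A" "0 \<le> h" and "\<And>i j. i \<in> S \<Longrightarrow> j \<notin> S \<Longrightarrow> h \<le> y i - y j"
  shows "h\<^sup>2 * cut_weight S A \<le> energy A y"
proof -
  have "(if (i \<in> S) \<noteq> (j \<in> S) then h\<^sup>2 else 0) \<le> (y j - y i)\<^sup>2" for i j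
    using assms(3)[of i j] assms(3)[of j i] assms(2) power_mono[of h "y i - y j" 2] power_mono[of h "y j - y i" 2]
    by (auto simp: power2_commute)
  then have "(\<Sum>i\<in>UNIV. \<Sum>j\<in>UNIV. A $ i $ j * (if (i \<in> S) \<noteq> (j \<in> S) then h\<^sup>2 else 0)) \<le> energy A y"
    unfolding energy_def using assms(1)
    by (intro sum_mono mult_left_mono) (auto simp: row_stochastic_def)
  also have "(\<Sum>i\<in>UNIV. \<Sum>j\<in>UNIV. A $ i $ j * (if (i \<in> S) \<noteq> (j \<in> S) then h\<^sup>2 else 0)) = h\<^sup>2 * cut_weight S A"
    unfolding cut_weight_def sum_distrib_left by (intro sum.cong) auto
  finally show ?thesis .
qed

lemma osc_iterate_le:
  fixes A :: "nat \<Rightarrow> real^'n^'n"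
  assumes A: "\<And>k. k < N \<Longrightarrow> row_stochastic (A k)"
    and z: "\<And>k i. k < N \<Longrightarrow> z (Suc k) i = (\<Sum>j\<in>UNIV. A k $ i $ j * z k j)"
    and "k \<le> N"
  shows "osc (z k) \<le> osc (z 0)"
  using \<open>k \<le> N\<close>
proof (induction k)
  case (Suc k)
  have "z (Suc k) = (\<lambda>i. \<Sum>j\<in>UNIV. A k $ i $ j * z k j)" using z[of k] Suc.prems by auto
  then have "osc (z (Suc k)) \<le> osc (z k)" using osc_average_le[OF A, of k "z k"] Suc.prems by simp
  then show ?case using Suc by simp
qed simp

text \<open>Values in \<open>S\<close> can be pulled down only by weight that crosses the cut. As
  the oscillation never grows, a step lowers the bound by at most the initial oscillation times the
  crossing weight of that step.\<close>

lemma iterate_lower_bound: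
  fixes A :: "nat \<Rightarrow> real^'n^'n"
  assumes A: "\<And>k. k < N \<Longrightarrow> row_stochastic (A k)"
    and z: "\<And>k i. k < N \<Longrightarrow> z (Suc k) i = (\<Sum>j\<in>UNIV. A k $ i $ j * z k j)"
    and lo: "\<And>i. i \<in> S \<Longrightarrow> b \<le> z 0 i" and "k \<le> N" "i \<in> S"
  shows "b - osc (z 0) * (\<Sum>l<k. cut_weight S (A l)) \<le> z k i"
  using \<open>k \<le> N\<close> \<open>i \<in> S\<close>
proof (induction k arbitrary: i)
  case (Suc k)
  have le: "osc (z k) \<le> osc (z 0)" using Suc.prems by (intro osc_iterate_le[where A = A and N = N]) (auto simp: A z)
  have "(b - osc (z 0) * (\<Sum>l<k. cut_weight S (A l))) - osc (z 0) * cut_weight S (A k) \<le> (\<Sum>j\<in>UNIV. A k $ i $ j * z k j)"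
  proof (rule cut_lower_step)
    show "z k l - z k j \<le> osc (z 0)" for l j
      using diff_le_osc[of "z k" l j] le by simp
  qed (use Suc A osc_nonneg in auto)
  then show ?case using z[of k i] Suc.prems by (simp add: algebra_simps)
qed (simp add: lo)

text \<open>The comparison of \<open>e\<close> with \<open>c\<close> is available only until the
  partial sums of \<open>c\<close> exceed \<theta>. The step that first exceeds \<theta> is still
  covered, and afterwards the truncation at \<theta> makes non-negativity of \<open>e\<close>
  sufficient.\<close>

lemma truncated_sum_bound:
  fixes c e :: "nat \<Rightarrow> real"
  assumes "\<And>l. l < N \<Longrightarrow> 0 \<le> e l" "\<And>l. l < N \<Longrightarrow> (\<Sum>m<l. c m) \<le> \<theta> \<Longrightarrow> h * c l \<le> e l" "0 \<le> h"
  shows "h * min (\<Sum>l<N. c l) \<theta> \<le> (\<Sum>l<N. e l)"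
  using assms(1,2)
proof (induction N)
  case 0
  then show ?case using \<open>0 \<le> h\<close> by (simp add: mult_nonneg_nonpos)
next
  case (Suc N)
  have IH: "h * min (\<Sum>l<N. c l) \<theta> \<le> (\<Sum>l<N. e l)" using Suc by simp
  show ?case
  proof (cases "(\<Sum>l<N. c l) \<le> \<theta>")
    case True
    have "h * min (\<Sum>l<Suc N. c l) \<theta> \<le> h * ((\<Sum>l<N. c l) + c N)"
      using \<open>0 \<le> h\<close> by (intro mult_left_mono) auto
    also have "\<dots> \<le> (\<Sum>l<Suc N. e l)" using Suc.prems(2)[of N] True IH by (simp add: algebra_simps)
    finally show ?thesis .
  next
    case False
    have "h * min (\<Sum>l<Suc N. c l) \<theta> \<le> h * \<theta>"
      using \<open>0 \<le> h\<close> by (intro mult_left_mono) auto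
    then show ?thesis using Suc.prems(1)[of N] False IH by (simp add: min_def split: if_splits)
  qed
qed

text \<open>As long as the accumulated cut weight is at most \<open>1 / (4 n)\<close>, at least half of a gap of
  relative size \<open>1 / n\<close> across the cut persists, so that every crossing weight costs energy.\<close>

lemma energy_block_ge:
  fixes A :: "nat \<Rightarrow> real^'n^'n"
  defines "n \<equiv> real CARD('n)"
  assumes A: "\<And>k. k < N \<Longrightarrow> row_stochastic (A k)"
    and z: "\<And>k i. k < N \<Longrightarrow> z (Suc k) i = (\<Sum>j\<in>UNIV. A k $ i $ j * z k j)"
    and gap: "\<And>i j. i \<in> S \<Longrightarrow> j \<notin> S \<Longrightarrow> osc (z 0) / n \<le> z 0 i - z 0 j"
    and "0 < N"
  shows "(osc (z 0))\<^sup>2 / (16 * n ^ 4 * real N) * (\<Sum>k<N. cut_weight S (A k)) \<le> (\<Sum>k<N. energy (A k) (z k))"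
proof -
  define d where "d = osc (z 0)"
  define C where "C k = (\<Sum>l<k. cut_weight S (A l))" for k
  have n: "1 \<le> n" unfolding n_def by (simp add: Suc_leI)
  have d0: "0 \<le> d" unfolding d_def by (rule osc_nonneg)
  have gapk: "d / (2 * n) \<le> z k i - z k j"
    if k: "k \<le> N" "C k \<le> 1 / (4 * n)" and ij: "i \<in> S" "j \<notin> S" for k i j
  proof -
    \<comment> \<open>The worst pair at the start: \<open>i'\<close> has the lowest value in
      \<open>S\<close> and \<open>j'\<close> the highest value outside.\<close>
    obtain i' where i': "i' \<in> S" "\<And>l. l \<in> S \<Longrightarrow> z 0 i' \<le> z 0 l"
      using ij finite_has_minimal[of "z 0 ` S"] by (metis finite arg_min_if_finite(1) arg_min_least empty_iff)
    obtain j' where j': "j' \<notin> S" "\<And>l. l \<notin> S \<Longrightarrow> z 0 l \<le> z 0 j'"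
      using ij obtains_MAX[of "- S" "z 0"] by (metis Compl_iff Max_ge empty_iff finite finite_imageI imageI)
    have lo: "z 0 i' - d * C k \<le> z k i"
      unfolding d_def C_def using k ij i' by (intro iterate_lower_bound[where N = N]) (auto simp: A z)
    \<comment> \<open>The upper bound outside \<open>S\<close> is the lower bound for the negated
      process on the complement.\<close>
    have "- z 0 j' - osc (\<lambda>i. - z 0 i) * (\<Sum>l<k. cut_weight (- S) (A l)) \<le> - z k j"
      by (rule iterate_lower_bound[of N A "\<lambda>k i. - z k i" "- S" "- z 0 j'" k j])
        (use k ij j' in \<open>auto simp: A z sum_negf\<close>)
    then have up: "- z 0 j' - osc (\<lambda>i. - z 0 i) * C k \<le> - z k j"
      by (simp add: cut_weight_Compl C_def)
    have "0 \<le> C k" unfolding C_def using k A by (auto intro!: sum_nonneg cut_weight_nonneg)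
    moreover have "osc (\<lambda>i. - z 0 i) \<le> d"
      unfolding d_def by (rule osc_leI) (use diff_le_osc[of "z 0"] in auto)
    ultimately have "osc (\<lambda>i. - z 0 i) * C k \<le> d * C k"
      by (rule mult_right_mono[rotated])
    then have "z 0 i' - d * C k - (z 0 j' + d * C k) \<le> z k i - z k j" using lo up by linarith
    \<comment> \<open>The initial gap is at least \<open>e = d / n\<close>. Each side loses at most
      \<open>e / 4\<close>, so \<open>e / 2\<close> is left.\<close>
    moreover define e where "e = d / n"
    have "d * C k \<le> d * (1 / (4 * n))" using k d0 by (intro mult_left_mono) auto
    then have "4 * (d * C k) \<le> e" by (simp add: e_def)
    moreover have "e \<le> z 0 i' - z 0 j'" using gap[OF i'(1) j'(1)] by (simp add: d_def e_def)
    moreover have "d / (2 * n) = e / 2" by (simp add: e_def)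
    ultimately show ?thesis by linarith
  qed
  have "(d / (2 * n))\<^sup>2 * min (C N) (1 / (4 * n)) \<le> (\<Sum>k<N. energy (A k) (z k))"
    unfolding C_def
  proof (rule truncated_sum_bound)
    show "(d / (2 * n))\<^sup>2 * cut_weight S (A l) \<le> energy (A l) (z l)"
      if "l < N" "(\<Sum>m<l. cut_weight S (A m)) \<le> 1 / (4 * n)" for l
      using that A d0 n by (intro cut_energy_le gapk) (auto simp: C_def)
  qed (use A in \<open>auto intro: energy_nonneg\<close>)
  \<comment> \<open>The truncated sum is replaced by a linear minorant, using
    \<open>C N \<le> n * real N\<close>. Linearity in the cut weights allows conditional
    expectations to be taken later.\<close>
  moreover have "C N / (4 * n * (n * real N)) \<le> min (C N) (1 / (4 * n))"
  proof -
    have "0 \<le> C N" unfolding C_def using A by (auto intro!: sum_nonneg cut_weight_nonneg)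
    have "C N \<le> (\<Sum>k<N. n)" unfolding C_def n_def by (intro sum_mono cut_weight_le A) auto
    then have "C N \<le> n * real N" by (simp add: mult.commute)
    moreover have "1 * 1 \<le> n * real N" using n \<open>0 < N\<close> by (intro mult_mono) auto
    moreover have "C N / (n * real N) \<le> 1" using \<open>C N \<le> n * real N\<close> n \<open>0 < N\<close> by (simp add: divide_simps)
    then have "C N / (n * real N) / (4 * n) \<le> 1 / (4 * n)" using n by (intro divide_right_mono) auto
    moreover have "1 * 1 \<le> 4 * n * (n * real N)" using calculation n by (intro mult_mono) auto
    then have "C N / (4 * n * (n * real N)) \<le> C N / 1"
      using \<open>0 \<le> C N\<close> by (intro divide_left_mono) auto
    ultimately show ?thesis by (simp add: mult.commute)
  qed
  then have "(d / (2 * n))\<^sup>2 * (C N / (4 * n * (n * real N))) \<le> (d / (2 * n))\<^sup>2 * min (C N) (1 / (4 * n))"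
    by (intro mult_left_mono) auto
  moreover have "(d / (2 * n))\<^sup>2 * (C N / (4 * n * (n * real N))) = d\<^sup>2 / (16 * n ^ 4 * real N) * C N"
    using n by (simp add: field_simps power2_eq_square power4_eq_xxxx)
  ultimately show ?thesis by (simp add: d_def C_def)
qed

text \<open>Of the \<open>n\<close> subintervals of equal length that partition the range of \<open>z\<close>, one contains no
  value of \<open>z\<close>, since the minimum lies in none of these left-open intervals.\<close>

lemma gap_exists:
  fixes z :: "'n::finite \<Rightarrow> real"
  assumes "0 < osc z"
  shows "\<exists>S. S \<noteq> {} \<and> S \<noteq> UNIV \<and> (\<forall>i\<in>S. \<forall>j\<in>-S. osc z / real CARD('n) \<le> z i - z j)"
proof -
  define n where "n = CARD('n)"
  define h where "h = osc z / real n"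
  define a where "a = Min (range z)"
  have n: "0 < n" unfolding n_def by simp
  have h: "0 < h" unfolding h_def using assms n by simp
  have "a \<in> range z" "Max (range z) \<in> range z" unfolding a_def by (auto intro: Max_in Min_in)
  then obtain i0 i1 where i0: "z i0 = a" and i1: "z i1 = Max (range z)" by (metis rangeE)
  have i1': "z i1 = a + real n * h" unfolding i1 h_def a_def osc_def using n by simp
  have "\<exists>k<n. \<forall>i. \<not> (a + real k * h < z i \<and> z i \<le> a + real (Suc k) * h)"
  proof (rule ccontr)
    assume "\<not> ?thesis"
    then have "\<forall>k. \<exists>i. k < n \<longrightarrow> a + real k * h < z i \<and> z i \<le> a + real (Suc k) * h" by blast
    then obtain f where f: "\<And>k. k < n \<Longrightarrow> a + real k * h < z (f k) \<and> z (f k) \<le> a + real (Suc k) * h"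
      by metis
    \<comment> \<open>Choosing a value from each of the \<open>n\<close> disjoint intervals would
      use every index, including the index \<open>i0\<close> of the minimum, which lies in none of
      them.\<close>
    have "inj_on f {..<n}"
    proof (rule linorder_inj_onI')
      fix k l assume kl: "k \<in> {..<n}" "l \<in> {..<n}" "k < l"
      have "real (Suc k) * h \<le> real l * h" using kl h by (intro mult_right_mono) auto
      then show "f k \<noteq> f l" using f[of k] f[of l] kl by force
    qed
    then have "card (f ` {..<n}) = n" by (simp add: card_image)
    then have "f ` {..<n} = UNIV" by (metis n_def card_eq_UNIV_imp_eq_UNIV finite)
    then obtain k where "k < n" "f k = i0" by (metis UNIV_I imageE lessThan_iff)
    then have "real k * h < 0" using f[of k] i0 by simp
    then show False using h by (simp add: mult_less_0_iff)
  qed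
  then obtain k where k: "k < n" and empty: "\<And>i. \<not> (a + real k * h < z i \<and> z i \<le> a + real (Suc k) * h)"
    by blast
  \<comment> \<open>The last interval contains the maximum, so the empty interval has values above
    it.\<close>
  have "k \<noteq> n - 1"
  proof
    assume "k = n - 1"
    then have "Suc k = n" using k by simp
    then have "z i1 \<le> a + real (Suc k) * h" "a + real k * h < z i1"
      using i1' h k by auto
    then show False using empty by blast
  qed
  then have kn: "Suc k < n" using k by simp
  define S where "S = {i. a + real (Suc k) * h < z i}"
  have "i1 \<in> S" unfolding S_def using i1' kn h by (simp only: mem_Collect_eq) auto
  moreover have "i0 \<notin> S" unfolding S_def using i0 h by (auto simp: not_less intro!: mult_nonneg_nonneg)
  moreover have "h \<le> z i - z j" if "i \<in> S" "j \<in> - S" for i j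
  proof -
    have "z j \<le> a + real k * h" using empty[of j] that by (auto simp: S_def)
    moreover have "a + real k * h + h < z i" using that by (simp add: S_def algebra_simps)
    ultimately show ?thesis by simp
  qed
  ultimately show ?thesis unfolding h_def n_def by (intro exI[of _ S]) blast
qed

lemma spanning_tree_crosses_cut:
  assumes "has_spanning_rooted_tree E" "S \<noteq> {}" "S \<noteq> UNIV"
  shows "\<exists>(j, i)\<in>E. (i \<in> S) \<noteq> (j \<in> S)"
proof (rule ccontr)
  assume no: "\<not> ?thesis"
  obtain r where r: "\<And>v. v \<noteq> r \<Longrightarrow> (r, v) \<in> E\<^sup>+"
    using assms(1) unfolding has_spanning_rooted_tree_def by blast
  \<comment> \<open>If no edge crosses the cut, every path from the root stays on the root's
    side.\<close>
  have "(v \<in> S) = (r \<in> S)" if "(r, v) \<in> E\<^sup>+" for v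
    using that by (induction rule: trancl_induct) (use no in blast)+
  then have "(v \<in> S) = (r \<in> S)" for v using r by (cases "v = r") auto
  then show False using assms by auto
qed

section \<open>Random averaging processes\<close>

lemma row_stochastic_entry_le_1:
  fixes A :: "real^'n^'n"
  assumes "row_stochastic A"
  shows "A $ i $ j \<le> 1"
proof -
  have "A $ i $ j \<le> (\<Sum>j\<in>UNIV. A $ i $ j)"
    by (rule member_le_sum) (use assms in \<open>auto simp: row_stochastic_def\<close>)
  then show ?thesis using assms by (simp add: row_stochastic_def)
qed

lemma (in prob_space) integrable_unit_interval:
  fixes f :: "'a \<Rightarrow> real"
  assumes "f \<in> borel_measurable M" "AE \<omega> in M. 0 \<le> f \<omega> \<and> f \<omega> \<le> 1"
  shows "integrable M f"
  by (rule integrable_const_bound[where B = 1]) (use assms in auto)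

lemma sq_diff_unit: "0 \<le> a \<and> a \<le> 1 \<Longrightarrow> 0 \<le> b \<and> b \<le> 1 \<Longrightarrow> 0 \<le> (a - b)\<^sup>2 \<and> (a - b)\<^sup>2 \<le> (1::real)"
  by (auto simp: abs_square_le_1 abs_le_iff)

section \<open>Random matrices: almost sure bounds and conditional cut weights\<close>

locale random_averaging = prob_space M + filtration "space M" F
  for M :: "'w measure" and F :: "nat \<Rightarrow> 'w measure" +
  fixes W :: "nat \<Rightarrow> 'w \<Rightarrow> real^'n^'n" and \<gamma> :: real and t0 B :: nat
  assumes subalg: "\<And>t. subalgebra M (F t)"
    and W_measurable: "\<And>t. W t \<in> borel_measurable (F t)"
    and row: "\<And>t. t0 \<le> t \<Longrightarrow> AE \<omega> in M. row_stochastic (W t \<omega>)"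
    and column: "\<And>t. t0 \<le> t \<Longrightarrow> AE \<omega> in M. column_stochastic (cond_exp_matrix M (F t) (W (Suc t)) \<omega>)"
    and gamma: "0 < \<gamma>" "\<gamma> < 1"
    and diagonal: "\<And>t. t0 \<le> t \<Longrightarrow> AE \<omega> in M. \<forall>i. (i, i) \<in> edges \<gamma> (W t \<omega>)"
    and B_pos: "0 < B"
    and tree: "\<And>t. t0 \<le> t \<Longrightarrow> AE \<omega> in M. has_spanning_rooted_tree
           (\<Union>\<tau>\<in>{t * B + 1..(t + 1) * B}. edges \<gamma> (cond_exp_matrix M (F (t * B)) (W \<tau>) \<omega>))"
begin

text \<open>One event for all times at once. It has full measure as a countable intersection, and on
  it the pathwise lemmas apply.\<close>

definition good :: "'w \<Rightarrow> bool" where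
  "good \<omega> \<longleftrightarrow> \<omega> \<in> space M \<and> (\<forall>t\<ge>t0. row_stochastic (W t \<omega>) \<and> (\<forall>i. \<gamma> \<le> W t \<omega> $ i $ i))"

lemma AE_good: "AE \<omega> in M. good \<omega>"
proof -
  have "AE \<omega> in M. \<forall>t. t0 \<le> t \<longrightarrow> row_stochastic (W t \<omega>) \<and> (\<forall>i. \<gamma> \<le> W t \<omega> $ i $ i)"
    unfolding AE_all_countable
  proof (intro allI)
    fix t show "AE \<omega> in M. t0 \<le> t \<longrightarrow> row_stochastic (W t \<omega>) \<and> (\<forall>i. \<gamma> \<le> W t \<omega> $ i $ i)"
    proof (cases "t0 \<le> t")
      case True
      show ?thesis using row[OF True] diagonal[OF True]
        by eventually_elim (auto simp: edges_def intro: less_imp_le)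
    qed simp
  qed
  then show ?thesis unfolding good_def by (auto simp: AE_conj_iff)
qed

lemma good_row: "good \<omega> \<Longrightarrow> t0 \<le> t \<Longrightarrow> row_stochastic (W t \<omega>)"
  and good_diagonal: "good \<omega> \<Longrightarrow> t0 \<le> t \<Longrightarrow> \<gamma> \<le> W t \<omega> $ i $ i"
  by (auto simp: good_def)

lemma good_entry:
  assumes "good \<omega>" "t0 \<le> t" shows "0 \<le> W t \<omega> $ i $ j" "W t \<omega> $ i $ j \<le> 1"
  using good_row[OF assms] row_stochastic_entry_le_1 by (auto simp: row_stochastic_def)

lemma F_mono: "f \<in> borel_measurable (F s) \<Longrightarrow> s \<le> t \<Longrightarrow> f \<in> borel_measurable (F t)"
  by (rule measurable_from_subalg[of "F t" "F s"]) (auto simp: subalgebra_def space_F sets_F_mono)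

lemma F_imp_M: "f \<in> borel_measurable (F s) \<Longrightarrow> f \<in> borel_measurable M"
  by (rule measurable_from_subalg[OF subalg])

lemma W_entry_measurable_F: "(\<lambda>\<omega>. W t \<omega> $ i $ j) \<in> borel_measurable (F t)"
proof -
  have "(\<lambda>A::real^'n^'n. A $ i $ j) \<in> borel_measurable borel"
    by (intro borel_measurable_continuous_onI continuous_intros)
  from measurable_compose[OF W_measurable this] show ?thesis .
qed

lemma W_entry_measurable [measurable]: "(\<lambda>\<omega>. W t \<omega> $ i $ j) \<in> borel_measurable M"
  by (rule F_imp_M[OF W_entry_measurable_F])

lemma sigma_finite_F: "sigma_finite_subalgebra M (F t)"
  by (rule finite_measure_subalgebra_is_sigma_finite)
    (auto simp: finite_measure_subalgebra_def finite_measure_subalgebra_axioms_def subalg finite_measure_axioms)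

text \<open>A bounded weight known at time \<open>r\<close> passes through the conditional
  expectation. This is how hypotheses on conditional means become statements about expectations
  involving \<open>W\<close> itself.\<close>

lemma integral_mult_cond_exp:
  assumes f: "f \<in> borel_measurable (F r)" and f01: "AE \<omega> in M. 0 \<le> f \<omega> \<and> f \<omega> \<le> 1" and t: "t0 \<le> t"
  shows "integrable M (\<lambda>\<omega>. f \<omega> * W t \<omega> $ i $ j)"
    and "integrable M (\<lambda>\<omega>. f \<omega> * cond_exp_matrix M (F r) (W t) \<omega> $ i $ j)"
    and "(\<integral>\<omega>. f \<omega> * W t \<omega> $ i $ j \<partial>M) = (\<integral>\<omega>. f \<omega> * cond_exp_matrix M (F r) (W t) \<omega> $ i $ j \<partial>M)"
proof -
  have [measurable]: "f \<in> borel_measurable M" using f by (rule F_imp_M)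
  show *: "integrable M (\<lambda>\<omega>. f \<omega> * W t \<omega> $ i $ j)"
  proof (rule integrable_unit_interval)
    show "AE \<omega> in M. 0 \<le> f \<omega> * W t \<omega> $ i $ j \<and> f \<omega> * W t \<omega> $ i $ j \<le> 1"
      using f01 AE_good by eventually_elim (auto simp: good_entry t intro!: mult_le_one)
  qed measurable
  show "integrable M (\<lambda>\<omega>. f \<omega> * cond_exp_matrix M (F r) (W t) \<omega> $ i $ j)"
    "(\<integral>\<omega>. f \<omega> * W t \<omega> $ i $ j \<partial>M) = (\<integral>\<omega>. f \<omega> * cond_exp_matrix M (F r) (W t) \<omega> $ i $ j \<partial>M)"
    using sigma_finite_subalgebra.real_cond_exp_intg[OF sigma_finite_F * f W_entry_measurable]
    by (simp_all add: cond_exp_matrix_def)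
qed

lemma AE_cond_exp_nonneg:
  assumes "t0 \<le> t"
  shows "AE \<omega> in M. \<forall>i j. 0 \<le> cond_exp_matrix M (F r) (W t) \<omega> $ i $ j"
proof -
  have "AE \<omega> in M. 0 \<le> real_cond_exp M (F r) (\<lambda>\<omega>'. W t \<omega>' $ i $ j) \<omega>" for i j
    by (rule sigma_finite_subalgebra.real_cond_exp_pos[OF sigma_finite_F])
      (use AE_good good_entry assms in auto)
  then show ?thesis by (simp add: cond_exp_matrix_def AE_all_countable)
qed

text \<open>Only the cut weight accumulated over a block is bounded below: the spanning tree of the
  block has an edge across \<open>S\<close>, in an unspecified direction and at an unspecified time.\<close>

lemma expected_cut_weight_ge:
  assumes t: "t0 \<le> t" and S: "S \<noteq> {}" "S \<noteq> UNIV"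
    and f: "f \<in> borel_measurable (F (t * B))" and f01: "AE \<omega> in M. 0 \<le> f \<omega> \<and> f \<omega> \<le> 1"
  shows "\<gamma> * (\<integral>\<omega>. f \<omega> \<partial>M) \<le> (\<integral>\<omega>. f \<omega> * (\<Sum>k<B. cut_weight S (W (t * B + Suc k) \<omega>)) \<partial>M)"
proof -
  let ?T = "t * B"
  let ?P = "\<lambda>k \<omega>. cond_exp_matrix M (F ?T) (W (?T + Suc k)) \<omega>"
  have T: "t0 \<le> ?T + Suc k" for k
    using t B_pos by (metis One_nat_def Suc_leI le_trans le_add1 mult.right_neutral mult_le_mono2)
  note int = integral_mult_cond_exp[OF f f01 T]
  \<comment> \<open>Expanded into entries, so that each \<open>W\<close> entry can be exchanged for
    its conditional mean under the integral.\<close>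
  have lin: "f \<omega> * (\<Sum>k<B. cut_weight S (A k)) =
      (\<Sum>k<B. \<Sum>i\<in>UNIV. \<Sum>j\<in>UNIV. if (i \<in> S) \<noteq> (j \<in> S) then f \<omega> * A k $ i $ j else 0)" for \<omega> and A :: "nat \<Rightarrow> real^'n^'n"
    unfolding cut_weight_def sum_distrib_left by (intro sum.cong) auto
  have int_if: "integrable M (\<lambda>\<omega>. if (i \<in> S) \<noteq> (j \<in> S) then f \<omega> * W (?T + Suc k) \<omega> $ i $ j else 0)"
    "integrable M (\<lambda>\<omega>. if (i \<in> S) \<noteq> (j \<in> S) then f \<omega> * ?P k \<omega> $ i $ j else 0)"
    "(\<integral>\<omega>. (if (i \<in> S) \<noteq> (j \<in> S) then f \<omega> * W (?T + Suc k) \<omega> $ i $ j else 0) \<partial>M)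
      = (\<integral>\<omega>. (if (i \<in> S) \<noteq> (j \<in> S) then f \<omega> * ?P k \<omega> $ i $ j else 0) \<partial>M)" for i j k
    by (cases "(i \<in> S) = (j \<in> S)"; use int[of k i j] in simp)+
  have "(\<integral>\<omega>. f \<omega> * (\<Sum>k<B. cut_weight S (W (?T + Suc k) \<omega>)) \<partial>M)
      = (\<integral>\<omega>. f \<omega> * (\<Sum>k<B. cut_weight S (?P k \<omega>)) \<partial>M)"
    unfolding lin by (simp only: Bochner_Integration.integral_sum Bochner_Integration.integrable_sum int_if)
  moreover have "(\<integral>\<omega>. \<gamma> * f \<omega> \<partial>M) \<le> (\<integral>\<omega>. f \<omega> * (\<Sum>k<B. cut_weight S (?P k \<omega>)) \<partial>M)"
  proof (rule integral_mono_AE)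
    have "integrable M f" by (rule integrable_unit_interval[OF F_imp_M[OF f] f01])
    then show "integrable M (\<lambda>\<omega>. \<gamma> * f \<omega>)" by simp
    show "integrable M (\<lambda>\<omega>. f \<omega> * (\<Sum>k<B. cut_weight S (?P k \<omega>)))"
      unfolding lin by (simp only: Bochner_Integration.integrable_sum int_if)
    have "AE \<omega> in M. \<forall>k i j. 0 \<le> ?P k \<omega> $ i $ j"
      using AE_cond_exp_nonneg[OF T] unfolding AE_all_countable by simp
    then show "AE \<omega> in M. \<gamma> * f \<omega> \<le> f \<omega> * (\<Sum>k<B. cut_weight S (?P k \<omega>))"
      using f01 tree[OF t]
    proof eventually_elim
      case (elim \<omega>)
      obtain i j \<tau> where e: "\<tau> \<in> {t * B + 1..(t + 1) * B}" "(i \<in> S) \<noteq> (j \<in> S)"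
        "(j, i) \<in> edges \<gamma> (cond_exp_matrix M (F ?T) (W \<tau>) \<omega>)"
        using spanning_tree_crosses_cut[OF elim(3) S] by blast
      \<comment> \<open>Block times run from \<open>t * B + 1\<close> to \<open>t * B + B\<close>,
        while \<open>k\<close> counts from 0.\<close>
      define k where "k = \<tau> - ?T - 1"
      have k: "k < B" "\<tau> = ?T + Suc k" using e(1) by (auto simp: k_def algebra_simps)
      have nn: "0 \<le> cut_weight S (?P l \<omega>)" for l
        unfolding cut_weight_def using elim(1) by (intro sum_nonneg) auto
      have "\<gamma> \<le> ?P k \<omega> $ i $ j" using e(3) by (simp add: edges_def k)
      also have "\<dots> \<le> (\<Sum>j\<in>UNIV. if (i \<in> S) \<noteq> (j \<in> S) then ?P k \<omega> $ i $ j else 0)"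
        using member_le_sum[of j UNIV "\<lambda>j. if (i \<in> S) \<noteq> (j \<in> S) then ?P k \<omega> $ i $ j else 0"] e(2) elim(1)
        by auto
      also have "\<dots> \<le> cut_weight S (?P k \<omega>)"
        unfolding cut_weight_def using elim(1)
        by (intro member_le_sum[of i UNIV "\<lambda>i. \<Sum>j\<in>UNIV. if (i \<in> S) \<noteq> (j \<in> S) then ?P k \<omega> $ i $ j else 0"] sum_nonneg) auto
      also have "\<dots> \<le> (\<Sum>k<B. cut_weight S (?P k \<omega>))"
        using k nn by (intro member_le_sum) auto
      finally show ?case using elim(2) by (subst mult.commute) (auto intro: mult_left_mono)
    qed
  qed
  ultimately show ?thesis by simp
qed

text \<open>The product of \<open>\<gamma> / 2\<close> from the dissipation in one step,
  \<open>\<gamma> / (16 * n ^ 4 * B)\<close> from the energy of a block, \<open>1 / 2 ^ n\<close>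
  for the choice of a cut, and \<open>1 / n\<close> from comparing squared deviation with squared
  oscillation, where \<open>n\<close> is \<open>CARD('n)\<close>.\<close>

definition rate :: real where
  "rate = \<gamma>\<^sup>2 / (32 * 2 ^ CARD('n) * real CARD('n) ^ 5 * real B)"

lemma rate_bounds: "0 < rate" "rate < 1"
proof -
  have n: "1 \<le> real CARD('n)" by (simp add: Suc_leI)
  have "1 * (1 * 1) \<le> (2::real) ^ CARD('n) * (real CARD('n) ^ 5 * real B)"
    using n B_pos by (intro mult_mono one_le_power) auto
  then have "1 < 32 * 2 ^ CARD('n) * real CARD('n) ^ 5 * real B" by (simp add: mult.assoc)
  moreover have "\<gamma>\<^sup>2 < 1" using gamma by (simp add: power_less_one_iff)
  ultimately show "rate < 1" unfolding rate_def by (subst divide_less_eq_1_pos) linarith+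
  show "0 < rate" unfolding rate_def using gamma B_pos by simp
qed

end

section \<open>Expected squared deviation of an averaging process\<close>

locale averaging_process = random_averaging M F W \<gamma> t0 B
  for M :: "'w measure" and F :: "nat \<Rightarrow> 'w measure"
    and W :: "nat \<Rightarrow> 'w \<Rightarrow> real^'n^'n" and \<gamma> :: real and t0 B :: nat +
  fixes s :: nat and Z :: "nat \<Rightarrow> 'w \<Rightarrow> 'n \<Rightarrow> real"
  assumes start: "t0 \<le> s"
    and Z_start_measurable: "\<And>i. (\<lambda>\<omega>. Z s \<omega> i) \<in> borel_measurable (F s)"
    and Z_start: "\<And>\<omega> i. 0 \<le> Z s \<omega> i \<and> Z s \<omega> i \<le> 1"
    and Z_step: "\<And>t \<omega> i. s \<le> t \<Longrightarrow> Z (Suc t) \<omega> i = (\<Sum>j\<in>UNIV. W (Suc t) \<omega> $ i $ j * Z t \<omega> j)"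
begin

lemma Z_measurable_F: "s \<le> t \<Longrightarrow> (\<lambda>\<omega>. Z t \<omega> i) \<in> borel_measurable (F t)"
proof (induction t arbitrary: i rule: dec_induct)
  case base
  show ?case by (rule Z_start_measurable)
next
  case (step t)
  have "(\<lambda>\<omega>. Z t \<omega> j) \<in> borel_measurable (F (Suc t))" for j
    using step.IH by (rule F_mono) simp
  then show ?case using Z_step[OF step.hyps(1)] W_entry_measurable_F by simp
qed

lemma Z_measurable: "s \<le> t \<Longrightarrow> (\<lambda>\<omega>. Z t \<omega> i) \<in> borel_measurable M"
  by (rule F_imp_M[OF Z_measurable_F])

text \<open>Averaging keeps the unit interval; this bounds the squared oscillations, deviations and
  energies and so makes them integrable.\<close>

lemma Z_bounds:
  assumes "good \<omega>" "s \<le> t"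
  shows "0 \<le> Z t \<omega> i \<and> Z t \<omega> i \<le> 1"
  using \<open>s \<le> t\<close>
proof (induction t arbitrary: i rule: dec_induct)
  case base
  show ?case by (rule Z_start)
next
  case (step t)
  have "row_stochastic (W (Suc t) \<omega>)" using assms(1) start step.hyps by (intro good_row) auto
  from row_stochastic_average_mono(1)[OF this, of "Z t \<omega>" 1] row_stochastic_average_mono(2)[OF this, of 0 "Z t \<omega>"]
  show ?case using step.IH by (simp add: Z_step[OF step.hyps(1)])
qed

lemma osc_Z_bounds: "good \<omega> \<Longrightarrow> s \<le> t \<Longrightarrow> 0 \<le> osc (Z t \<omega>) \<and> osc (Z t \<omega>) \<le> 1"
  using Z_bounds[of \<omega> t] by (auto intro!: osc_leI osc_nonneg) (smt (verit))

lemma osc_Z_mono: "good \<omega> \<Longrightarrow> s \<le> t \<Longrightarrow> t \<le> t' \<Longrightarrow> osc (Z t' \<omega>) \<le> osc (Z t \<omega>)"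
  using osc_iterate_le[of "t' - t" "\<lambda>k. W (t + Suc k) \<omega>" "\<lambda>k. Z (t + k) \<omega>" "t' - t"] start
  by (auto simp: Z_step good_row)

lemma osc_sq_integrable: "s \<le> t \<Longrightarrow> integrable M (\<lambda>\<omega>. (osc (Z t \<omega>))\<^sup>2)"
proof (rule integrable_unit_interval)
  assume t: "s \<le> t"
  show "(\<lambda>\<omega>. (osc (Z t \<omega>))\<^sup>2) \<in> borel_measurable M"
    using borel_measurable_osc[of "Z t" M] Z_measurable[OF t] by simp
  show "AE \<omega> in M. 0 \<le> (osc (Z t \<omega>))\<^sup>2 \<and> (osc (Z t \<omega>))\<^sup>2 \<le> 1"
    using AE_good by eventually_elim (use osc_Z_bounds t in \<open>auto simp: power_le_one\<close>)
qed

lemma sq_dev_integrable: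
  assumes t: "s \<le> t" and c: "c \<in> borel_measurable M" and c01: "AE \<omega> in M. 0 \<le> c \<omega> \<and> c \<omega> \<le> 1"
  shows "integrable M (\<lambda>\<omega>. sq_dev (c \<omega>) (Z t \<omega>))"
proof -
  have *: "integrable M (\<lambda>\<omega>. (Z t \<omega> i - c \<omega>)\<^sup>2)" for i
  proof (rule integrable_unit_interval)
    show "(\<lambda>\<omega>. (Z t \<omega> i - c \<omega>)\<^sup>2) \<in> borel_measurable M" using Z_measurable[OF t] c by simp
    show "AE \<omega> in M. 0 \<le> (Z t \<omega> i - c \<omega>)\<^sup>2 \<and> (Z t \<omega> i - c \<omega>)\<^sup>2 \<le> 1"
      using c01 AE_good by eventually_elim (intro sq_diff_unit Z_bounds t)
  qed
  show "integrable M (\<lambda>\<omega>. sq_dev (c \<omega>) (Z t \<omega>))"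
    unfolding sq_dev_def using * by simp
qed

lemma energy_integrable:
  assumes t: "s \<le> t"
  shows "integrable M (\<lambda>\<omega>. energy (W (Suc t) \<omega>) (Z t \<omega>))"
  unfolding energy_def
proof (intro Bochner_Integration.integrable_sum integrable_unit_interval)
  fix i j
  show "(\<lambda>\<omega>. W (Suc t) \<omega> $ i $ j * (Z t \<omega> j - Z t \<omega> i)\<^sup>2) \<in> borel_measurable M"
    using Z_measurable[OF t] by simp
  have "t0 \<le> Suc t" using t start by simp
  show "AE \<omega> in M. 0 \<le> W (Suc t) \<omega> $ i $ j * (Z t \<omega> j - Z t \<omega> i)\<^sup>2 \<and>
     W (Suc t) \<omega> $ i $ j * (Z t \<omega> j - Z t \<omega> i)\<^sup>2 \<le> 1"
    using AE_good
  proof eventually_elim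
    case (elim \<omega>)
    show ?case using good_entry[OF elim \<open>t0 \<le> Suc t\<close>, of i j] sq_diff_unit[OF Z_bounds[OF elim t, of j] Z_bounds[OF elim t, of i]]
      by (auto intro: mult_le_one)
  qed
qed

text \<open>The squared deviations at time \<open>t\<close> are known at time \<open>t\<close>, so
  \<open>W (Suc t)\<close> may be replaced by its conditional mean, whose columns sum to 1. The
  leading term thus reproduces the old deviation, and the energy remains as the loss.\<close>

lemma expected_sq_dev_step:
  assumes t: "s \<le> t" and c: "c \<in> borel_measurable (F t)" and c01: "AE \<omega> in M. 0 \<le> c \<omega> \<and> c \<omega> \<le> 1"
  shows "(\<integral>\<omega>. sq_dev (c \<omega>) (Z (Suc t) \<omega>) \<partial>M)
    \<le> (\<integral>\<omega>. sq_dev (c \<omega>) (Z t \<omega>) \<partial>M) - \<gamma> / 2 * (\<integral>\<omega>. energy (W (Suc t) \<omega>) (Z t \<omega>) \<partial>M)"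
proof -
  let ?P = "\<lambda>\<omega>. cond_exp_matrix M (F t) (W (Suc t)) \<omega>"
  let ?D = "\<lambda>j \<omega>. (Z t \<omega> j - c \<omega>)\<^sup>2"
  have cM: "c \<in> borel_measurable M" using c by (rule F_imp_M)
  have t0: "t0 \<le> Suc t" "t0 \<le> t" using t start by auto
  have D_measurable: "?D j \<in> borel_measurable (F t)" for j using Z_measurable_F[OF t] c by simp
  have D01: "AE \<omega> in M. 0 \<le> ?D j \<omega> \<and> ?D j \<omega> \<le> 1" for j
    using c01 AE_good by eventually_elim (intro sq_diff_unit Z_bounds t)
  note int = integral_mult_cond_exp[OF D_measurable D01 t0(1)]
  have "(\<integral>\<omega>. sq_dev (c \<omega>) (Z (Suc t) \<omega>) \<partial>M)
      \<le> (\<integral>\<omega>. (\<Sum>j\<in>UNIV. \<Sum>i\<in>UNIV. ?D j \<omega> * W (Suc t) \<omega> $ i $ j) - \<gamma> / 2 * energy (W (Suc t) \<omega>) (Z t \<omega>) \<partial>M)"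
  proof (rule integral_mono_AE)
    show "integrable M (\<lambda>\<omega>. sq_dev (c \<omega>) (Z (Suc t) \<omega>))" using t by (intro sq_dev_integrable cM c01) simp
    show "integrable M (\<lambda>\<omega>. (\<Sum>j\<in>UNIV. \<Sum>i\<in>UNIV. ?D j \<omega> * W (Suc t) \<omega> $ i $ j) - \<gamma> / 2 * energy (W (Suc t) \<omega>) (Z t \<omega>))"
      using int energy_integrable[OF t] by simp
    show "AE \<omega> in M. sq_dev (c \<omega>) (Z (Suc t) \<omega>)
      \<le> (\<Sum>j\<in>UNIV. \<Sum>i\<in>UNIV. ?D j \<omega> * W (Suc t) \<omega> $ i $ j) - \<gamma> / 2 * energy (W (Suc t) \<omega>) (Z t \<omega>)"
      using AE_good
    proof eventually_elim
      case (elim \<omega>)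
      have "Z (Suc t) \<omega> = (\<lambda>i. \<Sum>j\<in>UNIV. W (Suc t) \<omega> $ i $ j * Z t \<omega> j)" using Z_step[OF t] by auto
      then show ?case
        using sq_dev_average_le[OF good_row[OF elim t0(1)] good_diagonal[OF elim t0(1)], of "c \<omega>" "Z t \<omega>"] gamma
        by (simp add: mult.commute)
    qed
  qed
  also have "\<dots> = (\<integral>\<omega>. (\<Sum>j\<in>UNIV. \<Sum>i\<in>UNIV. ?D j \<omega> * W (Suc t) \<omega> $ i $ j) \<partial>M)
      - \<gamma> / 2 * (\<integral>\<omega>. energy (W (Suc t) \<omega>) (Z t \<omega>) \<partial>M)"
    using int energy_integrable[OF t] by simp
  also have "(\<integral>\<omega>. (\<Sum>j\<in>UNIV. \<Sum>i\<in>UNIV. ?D j \<omega> * W (Suc t) \<omega> $ i $ j) \<partial>M)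
      = (\<integral>\<omega>. (\<Sum>j\<in>UNIV. \<Sum>i\<in>UNIV. ?D j \<omega> * ?P \<omega> $ i $ j) \<partial>M)"
    by (simp only: Bochner_Integration.integral_sum Bochner_Integration.integrable_sum int)
  also have "\<dots> = (\<integral>\<omega>. sq_dev (c \<omega>) (Z t \<omega>) \<partial>M)"
  proof (rule integral_cong_AE)
    show "(\<lambda>\<omega>. \<Sum>j\<in>UNIV. \<Sum>i\<in>UNIV. ?D j \<omega> * ?P \<omega> $ i $ j) \<in> borel_measurable M"
      using int by (intro borel_measurable_integrable) simp
    show "(\<lambda>\<omega>. sq_dev (c \<omega>) (Z t \<omega>)) \<in> borel_measurable M"
      by (intro borel_measurable_integrable sq_dev_integrable t cM c01)
    show "AE \<omega> in M. (\<Sum>j\<in>UNIV. \<Sum>i\<in>UNIV. ?D j \<omega> * ?P \<omega> $ i $ j) = sq_dev (c \<omega>) (Z t \<omega>)"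
      using column[OF t0(2)]
      by eventually_elim (simp add: sq_dev_def column_stochastic_def flip: sum_distrib_left)
  qed
  finally show ?thesis .
qed

text \<open>The centre is frozen at time \<open>t\<close>. It stays measurable for the later members
  of the filtration, so the one-step losses add up.\<close>

lemma expected_sq_dev_block:
  assumes t: "s \<le> t" and c: "c \<in> borel_measurable (F t)" and c01: "AE \<omega> in M. 0 \<le> c \<omega> \<and> c \<omega> \<le> 1"
  shows "(\<integral>\<omega>. sq_dev (c \<omega>) (Z (t + N) \<omega>) \<partial>M)
    \<le> (\<integral>\<omega>. sq_dev (c \<omega>) (Z t \<omega>) \<partial>M) - \<gamma> / 2 * (\<Sum>k<N. \<integral>\<omega>. energy (W (t + Suc k) \<omega>) (Z (t + k) \<omega>) \<partial>M)"
proof (induction N)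
  case (Suc N)
  have "(\<integral>\<omega>. sq_dev (c \<omega>) (Z (Suc (t + N)) \<omega>) \<partial>M)
    \<le> (\<integral>\<omega>. sq_dev (c \<omega>) (Z (t + N) \<omega>) \<partial>M) - \<gamma> / 2 * (\<integral>\<omega>. energy (W (Suc (t + N)) \<omega>) (Z (t + N) \<omega>) \<partial>M)"
    using t by (intro expected_sq_dev_step c01 F_mono[OF c]) auto
  with Suc show ?case by (simp add: algebra_simps)
qed simp

section \<open>Expected energy spent during a block\<close>

definition aligned :: "nat \<Rightarrow> 'n set \<Rightarrow> 'w \<Rightarrow> bool" where
  "aligned t S \<omega> \<longleftrightarrow> (\<forall>i\<in>S. \<forall>j\<in>-S. osc (Z t \<omega>) / real CARD('n) \<le> Z t \<omega> i - Z t \<omega> j)"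

text \<open>For a fixed \<open>S\<close>, alignment is decided at time \<open>t\<close>. Hence this
  function can serve as the weight \<open>f\<close> in
  \<open>expected_cut_weight_ge\<close>.\<close>

lemma aligned_measurable:
  assumes "s \<le> t"
  shows "(\<lambda>\<omega>. if aligned t S \<omega> then (osc (Z t \<omega>))\<^sup>2 else 0) \<in> borel_measurable (F t)"
proof -
  note [measurable] = Z_measurable_F[OF assms]
  have [measurable]: "(\<lambda>\<omega>. osc (Z t \<omega>)) \<in> borel_measurable (F t)"
    by (rule borel_measurable_osc) measurable
  show ?thesis unfolding aligned_def by measurable
qed

text \<open>On the event that \<open>S\<close> is aligned, \<open>energy_block_ge\<close> bounds the
  energy pathwise by the cut weight of \<open>S\<close>; off this event the weight \<open>f\<close>
  is zero. The expected weighted cut weight is then controlled by the spanning tree.\<close>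

lemma expected_energy_aligned:
  assumes t: "t0 \<le> t" "s \<le> t * B" and S: "S \<noteq> {}" "S \<noteq> UNIV"
  shows "\<gamma> / (16 * real CARD('n) ^ 4 * real B) * (\<integral>\<omega>. (if aligned (t * B) S \<omega> then (osc (Z (t * B) \<omega>))\<^sup>2 else 0) \<partial>M)
    \<le> (\<Sum>k<B. \<integral>\<omega>. energy (W (t * B + Suc k) \<omega>) (Z (t * B + k) \<omega>) \<partial>M)"
proof -
  let ?T = "t * B"
  define f where "f \<omega> = (if aligned ?T S \<omega> then (osc (Z ?T \<omega>))\<^sup>2 else 0)" for \<omega>
  define h where "h = 1 / (16 * real CARD('n) ^ 4 * real B)"
  have h: "0 < h" unfolding h_def using B_pos by simp
  have f: "f \<in> borel_measurable (F ?T)" unfolding f_def by (rule aligned_measurable[OF t(2)])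
  have f01: "AE \<omega> in M. 0 \<le> f \<omega> \<and> f \<omega> \<le> 1"
    using AE_good by eventually_elim (use osc_Z_bounds t in \<open>auto simp: f_def power_le_one\<close>)
  have le: "t0 \<le> ?T + Suc k" for k using t start by simp
  have int: "integrable M (\<lambda>\<omega>. energy (W (?T + Suc k) \<omega>) (Z (?T + k) \<omega>))" for k
    using energy_integrable[of "?T + k"] t by simp
  have "h * (\<gamma> * (\<integral>\<omega>. f \<omega> \<partial>M)) \<le> h * (\<integral>\<omega>. f \<omega> * (\<Sum>k<B. cut_weight S (W (?T + Suc k) \<omega>)) \<partial>M)"
    using h by (intro mult_left_mono expected_cut_weight_ge t S f f01) auto
  also have "\<dots> = (\<integral>\<omega>. h * (f \<omega> * (\<Sum>k<B. cut_weight S (W (?T + Suc k) \<omega>))) \<partial>M)" by simp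
  also have "\<dots> \<le> (\<integral>\<omega>. (\<Sum>k<B. energy (W (?T + Suc k) \<omega>) (Z (?T + k) \<omega>)) \<partial>M)"
  proof (rule integral_mono_AE)
    have "integrable M (\<lambda>\<omega>. if (i \<in> S) \<noteq> (j \<in> S) then f \<omega> * W (?T + Suc k) \<omega> $ i $ j else 0)" for i j k
      by (cases "(i \<in> S) = (j \<in> S)"; use integral_mult_cond_exp(1)[OF f f01 le, of k i j] in simp)
    moreover have "f \<omega> * (\<Sum>k<B. cut_weight S (W (?T + Suc k) \<omega>)) =
      (\<Sum>k<B. \<Sum>i\<in>UNIV. \<Sum>j\<in>UNIV. if (i \<in> S) \<noteq> (j \<in> S) then f \<omega> * W (?T + Suc k) \<omega> $ i $ j else 0)" for \<omega>
      unfolding cut_weight_def sum_distrib_left by (intro sum.cong) auto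
    ultimately show "integrable M (\<lambda>\<omega>. h * (f \<omega> * (\<Sum>k<B. cut_weight S (W (?T + Suc k) \<omega>))))"
      by simp
    show "integrable M (\<lambda>\<omega>. \<Sum>k<B. energy (W (?T + Suc k) \<omega>) (Z (?T + k) \<omega>))" using int by simp
    show "AE \<omega> in M. h * (f \<omega> * (\<Sum>k<B. cut_weight S (W (?T + Suc k) \<omega>)))
        \<le> (\<Sum>k<B. energy (W (?T + Suc k) \<omega>) (Z (?T + k) \<omega>))"
      using AE_good
    proof eventually_elim
      case (elim \<omega>)
      have row': "row_stochastic (W (?T + Suc k) \<omega>)" for k using elim le by (rule good_row)
      have step': "Z (?T + Suc k) \<omega> i = (\<Sum>j\<in>UNIV. W (?T + Suc k) \<omega> $ i $ j * Z (?T + k) \<omega> j)" for k i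
        using Z_step[of "?T + k"] t by simp
      show ?case
      proof (cases "aligned ?T S \<omega>")
        case True
        then have "(osc (Z (?T + 0) \<omega>))\<^sup>2 / (16 * real CARD('n) ^ 4 * real B) * (\<Sum>k<B. cut_weight S (W (?T + Suc k) \<omega>))
           \<le> (\<Sum>k<B. energy (W (?T + Suc k) \<omega>) (Z (?T + k) \<omega>))"
          by (intro energy_block_ge[of B "\<lambda>k. W (?T + Suc k) \<omega>" "\<lambda>k. Z (?T + k) \<omega>"] row' step' B_pos)
            (auto simp: aligned_def)
        then show ?thesis using True by (simp add: f_def h_def)
      next
        case False
        have "0 \<le> (\<Sum>k<B. energy (W (?T + Suc k) \<omega>) (Z (?T + k) \<omega>))"
          by (intro sum_nonneg energy_nonneg row')
        then show ?thesis using False by (simp add: f_def)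
      qed
    qed
  qed
  also have "\<dots> = (\<Sum>k<B. \<integral>\<omega>. energy (W (?T + Suc k) \<omega>) (Z (?T + k) \<omega>) \<partial>M)"
    using int by (intro Bochner_Integration.integral_sum) auto
  finally show ?thesis by (simp add: f_def h_def)
qed

text \<open>The cut with a large gap depends on \<open>\<omega>\<close>; summing over all cuts replaces it by a deterministic one.\<close>

lemma expected_energy_ge:
  assumes t: "t0 \<le> t" "s \<le> t * B"
  shows "\<gamma> / (16 * real CARD('n) ^ 4 * real B) * (\<integral>\<omega>. (osc (Z (t * B) \<omega>))\<^sup>2 \<partial>M)
    \<le> 2 ^ CARD('n) * (\<Sum>k<B. \<integral>\<omega>. energy (W (t * B + Suc k) \<omega>) (Z (t * B + k) \<omega>) \<partial>M)"
proof -
  let ?T = "t * B"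
  define f where "f S \<omega> = (if aligned ?T S \<omega> then (osc (Z ?T \<omega>))\<^sup>2 else 0)" for S \<omega>
  define h where "h = \<gamma> / (16 * real CARD('n) ^ 4 * real B)"
  define E where "E = (\<Sum>k<B. \<integral>\<omega>. energy (W (?T + Suc k) \<omega>) (Z (?T + k) \<omega>) \<partial>M)"
  \<comment> \<open>Only nonempty proper subsets are cuts that a spanning tree must cross.\<close>
  define P where "P = (UNIV - {{}, UNIV} :: 'n set set)"
  have h: "0 < h" unfolding h_def using B_pos gamma by simp
  have int: "integrable M (f S)" for S
  proof (rule integrable_unit_interval)
    show "f S \<in> borel_measurable M" unfolding f_def by (rule F_imp_M[OF aligned_measurable[OF t(2)]])
    show "AE \<omega> in M. 0 \<le> f S \<omega> \<and> f S \<omega> \<le> 1"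
      using AE_good by eventually_elim (use osc_Z_bounds t in \<open>auto simp: f_def power_le_one\<close>)
  qed
  have "0 \<le> E" unfolding E_def
  proof (intro sum_nonneg integral_nonneg_AE)
    fix k show "AE \<omega> in M. 0 \<le> energy (W (?T + Suc k) \<omega>) (Z (?T + k) \<omega>)"
      using AE_good by eventually_elim (use t start in \<open>auto intro!: energy_nonneg good_row\<close>)
  qed
  have "(osc (Z ?T \<omega>))\<^sup>2 \<le> (\<Sum>S\<in>P. f S \<omega>)" for \<omega>
  proof (cases "0 < osc (Z ?T \<omega>)")
    case True
    then obtain S where "S \<in> P" "aligned ?T S \<omega>"
      using gap_exists[of "Z ?T \<omega>"] unfolding aligned_def P_def by blast
    then have "(osc (Z ?T \<omega>))\<^sup>2 = f S \<omega>" by (simp add: f_def)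
    also have "\<dots> \<le> (\<Sum>S\<in>P. f S \<omega>)" using \<open>S \<in> P\<close> by (intro member_le_sum) (auto simp: f_def)
    finally show ?thesis .
  next
    case False
    then have "osc (Z ?T \<omega>) = 0" using osc_nonneg[of "Z ?T \<omega>"] by simp
    then show ?thesis by (auto simp: f_def intro!: sum_nonneg)
  qed
  then have "(\<integral>\<omega>. (osc (Z ?T \<omega>))\<^sup>2 \<partial>M) \<le> (\<integral>\<omega>. (\<Sum>S\<in>P. f S \<omega>) \<partial>M)"
    using int osc_sq_integrable[OF t(2)] by (intro integral_mono) auto
  also have "\<dots> = (\<Sum>S\<in>P. \<integral>\<omega>. f S \<omega> \<partial>M)" using int by simp
  finally have "h * (\<integral>\<omega>. (osc (Z ?T \<omega>))\<^sup>2 \<partial>M) \<le> h * (\<Sum>S\<in>P. \<integral>\<omega>. f S \<omega> \<partial>M)"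
    using h by (intro mult_left_mono) auto
  also have "\<dots> = (\<Sum>S\<in>P. h * (\<integral>\<omega>. f S \<omega> \<partial>M))" by (simp add: sum_distrib_left)
  \<comment> \<open>Each cut on its own satisfies the bound with the full energy \<open>E\<close>;
    summing over the cuts costs a factor of at most \<open>2 ^ CARD('n)\<close>.\<close>
  also have "\<dots> \<le> (\<Sum>S\<in>P. E)"
    using expected_energy_aligned[OF t] unfolding f_def h_def E_def P_def by (intro sum_mono) blast
  also have "\<dots> \<le> (\<Sum>S\<in>(UNIV :: 'n set set). E)" using \<open>0 \<le> E\<close> by (intro sum_mono2) auto
  also have "\<dots> = 2 ^ CARD('n) * E" by (simp add: card_UNIV_set)
  finally show ?thesis unfolding h_def E_def .
qed

section \<open>Geometric decay of the mean square oscillation\<close>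

definition lyapunov :: "nat \<Rightarrow> real" where
  "lyapunov t = (\<integral>\<omega>. sq_dev (mean (Z t \<omega>)) (Z t \<omega>) \<partial>M)"

lemma mean_Z:
  assumes "s \<le> t"
  shows "(\<lambda>\<omega>. mean (Z t \<omega>)) \<in> borel_measurable (F t)" "AE \<omega> in M. 0 \<le> mean (Z t \<omega>) \<and> mean (Z t \<omega>) \<le> 1"
proof -
  show "(\<lambda>\<omega>. mean (Z t \<omega>)) \<in> borel_measurable (F t)"
    unfolding mean_def using Z_measurable_F[OF assms] by simp
  show "AE \<omega> in M. 0 \<le> mean (Z t \<omega>) \<and> mean (Z t \<omega>) \<le> 1"
    using AE_good
  proof eventually_elim
    case (elim \<omega>)
    have "0 \<le> Min (range (Z t \<omega>))" "Max (range (Z t \<omega>)) \<le> 1"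
      using Z_bounds[OF elim assms] by auto
    then show ?case using mean_bounds[of "Z t \<omega>"] by linarith
  qed
qed

lemma lyapunov_integrable: "s \<le> t \<Longrightarrow> integrable M (\<lambda>\<omega>. sq_dev (mean (Z t \<omega>)) (Z t \<omega>))"
  by (intro sq_dev_integrable mean_Z F_imp_M[OF mean_Z(1)])

lemma lyapunov_le: "s \<le> t \<Longrightarrow> lyapunov t \<le> real CARD('n) * (\<integral>\<omega>. (osc (Z t \<omega>))\<^sup>2 \<partial>M)"
  unfolding lyapunov_def integral_mult_right_zero[symmetric]
  by (intro integral_mono lyapunov_integrable integrable_mult_right osc_sq_integrable sq_dev_mean_le_osc)

lemma expected_osc_sq_le_1:
  assumes "s \<le> t" shows "(\<integral>\<omega>. (osc (Z t \<omega>))\<^sup>2 \<partial>M) \<le> 1"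
proof -
  have "(\<integral>\<omega>. (osc (Z t \<omega>))\<^sup>2 \<partial>M) \<le> (\<integral>\<omega>. 1 \<partial>M)"
  proof (rule integral_mono_AE)
    show "AE \<omega> in M. (osc (Z t \<omega>))\<^sup>2 \<le> 1"
      using AE_good by eventually_elim (use osc_Z_bounds assms in \<open>auto simp: power_le_one\<close>)
  qed (use osc_sq_integrable assms in auto)
  then show ?thesis by (simp add: prob_space)
qed

lemma expected_osc_sq_le_lyapunov: "s \<le> t \<Longrightarrow> (\<integral>\<omega>. (osc (Z t \<omega>))\<^sup>2 \<partial>M) \<le> 4 * lyapunov t"
  unfolding lyapunov_def integral_mult_right_zero[symmetric]
  by (intro integral_mono lyapunov_integrable integrable_mult_right osc_sq_integrable osc_le_sq_dev)

text \<open>During the block the centre is the mean at its start; at the end it is exchanged for the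
  current mean, which minimises the deviation. The energy lost in between is a fixed fraction of the
  initial value.\<close>

lemma lyapunov_contraction:
  assumes t: "t0 \<le> t" "s \<le> t * B"
  shows "lyapunov (Suc t * B) \<le> (1 - rate) * lyapunov (t * B)"
proof -
  let ?T = "t * B" and ?c = "\<lambda>\<omega>. mean (Z (t * B) \<omega>)" and ?n = "real CARD('n)"
  let ?O = "\<integral>\<omega>. (osc (Z ?T \<omega>))\<^sup>2 \<partial>M"
  define E where "E = (\<Sum>k<B. \<integral>\<omega>. energy (W (?T + Suc k) \<omega>) (Z (?T + k) \<omega>) \<partial>M)"
  have "lyapunov (?T + B) \<le> (\<integral>\<omega>. sq_dev (?c \<omega>) (Z (?T + B) \<omega>) \<partial>M)"
    unfolding lyapunov_def using t
    by (intro integral_mono lyapunov_integrable sq_dev_integrable mean_Z F_imp_M[OF mean_Z(1)] sq_dev_mean_le) auto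
  also have "\<dots> \<le> lyapunov ?T - \<gamma> / 2 * E"
    unfolding lyapunov_def E_def by (intro expected_sq_dev_block t mean_Z)
  finally have 1: "lyapunov (?T + B) \<le> lyapunov ?T - \<gamma> / 2 * E" .
  have "rate * lyapunov ?T \<le> rate * (?n * ?O)"
    using rate_bounds by (intro mult_left_mono lyapunov_le t) auto
  also have "\<dots> = \<gamma> / (2 * 2 ^ CARD('n)) * (\<gamma> / (16 * ?n ^ 4 * real B) * ?O)"
    unfolding rate_def using B_pos by (simp add: divide_simps power2_eq_square eval_nat_numeral)
  also have "\<dots> \<le> \<gamma> / (2 * 2 ^ CARD('n)) * (2 ^ CARD('n) * E)"
    using expected_energy_ge[OF t] gamma unfolding E_def by (intro mult_left_mono) auto
  also have "\<dots> = \<gamma> / 2 * E" by simp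
  finally show ?thesis using 1 by (simp add: algebra_simps)
qed

lemma lyapunov_geometric:
  assumes t: "t0 \<le> t" "s \<le> t * B"
  shows "lyapunov ((t + k) * B) \<le> real CARD('n) * (1 - rate) ^ k"
proof (induction k)
  case 0
  have "lyapunov (t * B) \<le> real CARD('n) * (\<integral>\<omega>. (osc (Z (t * B) \<omega>))\<^sup>2 \<partial>M)"
    by (rule lyapunov_le[OF t(2)])
  also have "\<dots> \<le> real CARD('n) * 1"
    by (intro mult_left_mono expected_osc_sq_le_1 t) simp
  finally show ?case by simp
next
  case (Suc k)
  have "s \<le> (t + k) * B" using t(2) by (simp add: algebra_simps)
  then have "lyapunov (Suc (t + k) * B) \<le> (1 - rate) * lyapunov ((t + k) * B)"
    using t by (intro lyapunov_contraction) auto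
  also have "\<dots> \<le> (1 - rate) * (real CARD('n) * (1 - rate) ^ k)"
    using Suc rate_bounds by (intro mult_left_mono) auto
  finally show ?case by (simp add: mult_ac)
qed

text \<open>Contraction is known only between multiples of \<open>B\<close> from block
  \<open>t0\<close> on. Aligning \<open>s\<close> and \<open>t\<close> with blocks wastes at most
  \<open>(t0 + 2) * B\<close> steps, a number independent of \<open>s\<close>, which the constant
  absorbs.\<close>

lemma expected_osc_sq_decay:
  assumes r: "0 < r" "r < 1" "r ^ (2 * B) = 1 - rate" and t: "s \<le> t"
  shows "(\<integral>\<omega>. (osc (Z t \<omega>))\<^sup>2 \<partial>M) \<le> 4 * real CARD('n) / r ^ (2 * ((t0 + 2) * B)) * (r ^ (t - s))\<^sup>2"
proof -
  let ?n = "real CARD('n)"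
  \<comment> \<open>A block index that is admissible for \<open>tree\<close> and whose block begins
    after \<open>s\<close>.\<close>
  define m where "m = max t0 (s div B + 1)"
  have "s < (s div B + 1) * B"
    by (metis Suc_eq_plus1 B_pos dividend_less_div_times mult.commute mult_Suc)
  moreover have "(s div B + 1) * B \<le> m * B" unfolding m_def by (intro mult_le_mono1) simp
  ultimately have m: "t0 \<le> m" "s \<le> m * B" by (auto simp: m_def)
  have "m \<le> t0 + (s div B + 1)" by (simp add: m_def)
  then have "m * B \<le> (t0 + (s div B + 1)) * B" by (rule mult_le_mono1)
  also have "\<dots> \<le> s + (t0 + 1) * B"
    using div_times_less_eq_dividend[of s B] by (simp add: algebra_simps)
  finally have mB: "m * B \<le> s + (t0 + 1) * B" .
  \<comment> \<open>The subtraction is truncated: before the first usable block boundary the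
    exponent is 0 and the trivial bound 1 suffices.\<close>
  have "(\<integral>\<omega>. (osc (Z t \<omega>))\<^sup>2 \<partial>M) \<le> 4 * ?n * r ^ (2 * ((t - s) - (t0 + 2) * B))"
  proof (cases "m * B \<le> t")
    case True
    \<comment> \<open>The number of complete blocks that fit between \<open>m * B\<close> and
      \<open>t\<close>; the oscillation does not grow after the last of them.\<close>
    define k where "k = (t - m * B) div B"
    have "k * B \<le> t - m * B" unfolding k_def by (rule div_times_less_eq_dividend)
    then have k1: "(m + k) * B \<le> t" using True by (simp add: algebra_simps)
    have "t - m * B < k * B + B" unfolding k_def
      by (metis B_pos add.commute dividend_less_div_times)
    then have k2: "(t - s) - (t0 + 2) * B \<le> B * k" using mB by (simp add: algebra_simps)
    have sm: "s \<le> (m + k) * B" using m by (simp add: algebra_simps)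
    have "(\<integral>\<omega>. (osc (Z t \<omega>))\<^sup>2 \<partial>M) \<le> (\<integral>\<omega>. (osc (Z ((m + k) * B) \<omega>))\<^sup>2 \<partial>M)"
    proof (rule integral_mono_AE)
      show "AE \<omega> in M. (osc (Z t \<omega>))\<^sup>2 \<le> (osc (Z ((m + k) * B) \<omega>))\<^sup>2"
        using AE_good by eventually_elim (use osc_Z_mono sm k1 in \<open>auto intro!: power_mono osc_nonneg\<close>)
    qed (use osc_sq_integrable t sm in auto)
    also have "\<dots> \<le> 4 * lyapunov ((m + k) * B)" by (rule expected_osc_sq_le_lyapunov[OF sm])
    also have "\<dots> \<le> 4 * (?n * (1 - rate) ^ k)" using lyapunov_geometric[OF m] by simp
    also have "(1 - rate) ^ k = r ^ (2 * (B * k))" by (simp add: r(3)[symmetric] flip: power_mult) (simp add: mult.assoc)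
    also have "\<dots> \<le> r ^ (2 * ((t - s) - (t0 + 2) * B))"
      using r k2 by (intro power_decreasing) auto
    finally show ?thesis by (simp add: mult_left_mono)
  next
    case False
    then have "(t - s) - (t0 + 2) * B = 0" using mB by (simp add: algebra_simps)
    then have "4 * ?n * r ^ (2 * ((t - s) - (t0 + 2) * B)) = 4 * ?n" by simp
    moreover have "1 \<le> ?n" by (simp add: Suc_leI)
    ultimately show ?thesis using expected_osc_sq_le_1[OF t] by linarith
  qed
  also have "\<dots> \<le> 4 * ?n * (r ^ (2 * (t - s)) / r ^ (2 * ((t0 + 2) * B)))"
  proof (intro mult_left_mono)
    have "r ^ (2 * ((t - s) - (t0 + 2) * B)) * r ^ (2 * ((t0 + 2) * B)) \<le> r ^ (2 * (t - s))"
      unfolding power_add[symmetric] using r by (intro power_decreasing) auto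
    then show "r ^ (2 * ((t - s) - (t0 + 2) * B)) \<le> r ^ (2 * (t - s)) / r ^ (2 * ((t0 + 2) * B))"
      using r by (simp add: pos_le_divide_eq)
  qed simp
  finally show ?thesis by (simp add: power_even_eq)
qed

end

section \<open>Perturbed averaging\<close>

lemma infnorm_sum_le: "finite I \<Longrightarrow> infnorm (\<Sum>i\<in>I. f i) \<le> (\<Sum>i\<in>I. infnorm (f i))"
  by (induction rule: finite_induct) (auto simp: infnorm_0 intro: order_trans[OF infnorm_triangle])

lemma spread_eq_Max: "spread x = Max ((\<lambda>(i, j). infnorm (x $ i - x $ j)) ` UNIV)"
  unfolding spread_def by (rule arg_cong[of _ _ Max]) auto

lemma infnorm_le_spread: "infnorm (x $ i - x $ j) \<le> spread x"
  unfolding spread_eq_Max by (rule Max_ge) auto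

lemma spread_leI: "(\<And>i j. infnorm (x $ i - x $ j) \<le> d) \<Longrightarrow> spread x \<le> d"
  unfolding spread_eq_Max by (subst Max_le_iff) auto

lemma spread_nonneg: "0 \<le> spread x"
  using infnorm_le_spread[of x undefined undefined] infnorm_pos_le by (rule order_trans[rotated])

lemma spread_sum_le:
  assumes "finite I" shows "spread (\<Sum>l\<in>I. v l) \<le> (\<Sum>l\<in>I. spread (v l))"
proof (rule spread_leI)
  fix i j
  have "infnorm ((\<Sum>l\<in>I. v l) $ i - (\<Sum>l\<in>I. v l) $ j) = infnorm (\<Sum>l\<in>I. v l $ i - v l $ j)"
    by (simp add: sum_subtractf)
  also have "\<dots> \<le> (\<Sum>l\<in>I. infnorm (v l $ i - v l $ j))" by (rule infnorm_sum_le[OF assms])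
  also have "\<dots> \<le> (\<Sum>l\<in>I. spread (v l))" by (intro sum_mono infnorm_le_spread)
  finally show "infnorm ((\<Sum>l\<in>I. v l) $ i - (\<Sum>l\<in>I. v l) $ j) \<le> (\<Sum>l\<in>I. spread (v l))" .
qed

text \<open>A coefficient of ergodicity: it vanishes exactly when all rows of \<open>A\<close>
  agree.\<close>

definition column_osc :: "real^'n^'n \<Rightarrow> real" where
  "column_osc A = (\<Sum>j\<in>UNIV. osc (\<lambda>i. A $ i $ j))"

lemma column_osc_nonneg: "0 \<le> column_osc A"
  unfolding column_osc_def by (intro sum_nonneg osc_nonneg)

text \<open>As the rows have equal sums, the constant tuple \<open>b\<close> can be subtracted from
  \<open>y\<close> without changing the difference of two rows. Each remaining term is an entry
  difference within a column times a difference of entries of \<open>y\<close>.\<close>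

lemma spread_mult_le:
  fixes A :: "real^'n^'n" and y :: "real^'m^'n"
  assumes "row_stochastic A"
  shows "spread (A ** y) \<le> column_osc A * spread y"
proof (rule spread_leI)
  fix i k :: 'n
  define b where "b = y $ i"
  have one: "(\<Sum>j\<in>UNIV. A $ l $ j *\<^sub>R b) = b" for l
    using assms by (simp add: row_stochastic_def flip: scaleR_left.sum)
  have "(A ** y) $ i - (A ** y) $ k = (\<Sum>j\<in>UNIV. A $ i $ j *\<^sub>R y $ j) - (\<Sum>j\<in>UNIV. A $ k $ j *\<^sub>R y $ j)"
    by (simp add: matrix_mult_tuple_nth)
  also have "\<dots> = ((\<Sum>j\<in>UNIV. A $ i $ j *\<^sub>R y $ j) - (\<Sum>j\<in>UNIV. A $ i $ j *\<^sub>R b))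
      - ((\<Sum>j\<in>UNIV. A $ k $ j *\<^sub>R y $ j) - (\<Sum>j\<in>UNIV. A $ k $ j *\<^sub>R b))"
    unfolding one by simp
  also have "\<dots> = (\<Sum>j\<in>UNIV. (A $ i $ j - A $ k $ j) *\<^sub>R (y $ j - b))"
    by (simp add: sum_subtractf sum.distrib algebra_simps)
  finally have "infnorm ((A ** y) $ i - (A ** y) $ k) \<le> (\<Sum>j\<in>UNIV. infnorm ((A $ i $ j - A $ k $ j) *\<^sub>R (y $ j - b)))"
    by (simp add: infnorm_sum_le)
  also have "\<dots> \<le> (\<Sum>j\<in>UNIV. osc (\<lambda>i. A $ i $ j) * spread y)"
  proof (intro sum_mono)
    fix j
    have "\<bar>A $ i $ j - A $ k $ j\<bar> \<le> osc (\<lambda>i. A $ i $ j)"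
      using diff_le_osc[of "\<lambda>i. A $ i $ j" i k] diff_le_osc[of "\<lambda>i. A $ i $ j" k i] by (simp add: abs_le_iff)
    then show "infnorm ((A $ i $ j - A $ k $ j) *\<^sub>R (y $ j - b)) \<le> osc (\<lambda>i. A $ i $ j) * spread y"
      unfolding infnorm_mul b_def by (intro mult_mono infnorm_le_spread osc_nonneg infnorm_pos_le)
  qed
  also have "\<dots> = column_osc A * spread y" by (simp add: column_osc_def sum_distrib_right)
  finally show "infnorm ((A ** y) $ i - (A ** y) $ k) \<le> column_osc A * spread y" .
qed

section \<open>Products of matrices and the unrolled recursion\<close>

lemma row_stochastic_mult:
  fixes A C :: "real^'n^'n"
  assumes "row_stochastic A" "row_stochastic C"
  shows "row_stochastic (A ** C)"
proof -
  have "(\<Sum>j\<in>UNIV. \<Sum>k\<in>UNIV. A $ i $ k * C $ k $ j) = 1" for i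
    by (subst sum.swap) (use assms in \<open>simp add: row_stochastic_def flip: sum_distrib_left\<close>)
  then show ?thesis
    using assms unfolding row_stochastic_def by (auto simp: matrix_matrix_mult_def intro!: sum_nonneg)
qed

text \<open>The product \<open>A (s + k) ** ... ** A (s + 1)\<close>, which carries a state from
  time \<open>s\<close> to time \<open>s + k\<close>; the matrix at time \<open>s\<close> itself is
  not a factor.\<close>

primrec transition :: "(nat \<Rightarrow> real^'n^'n) \<Rightarrow> nat \<Rightarrow> nat \<Rightarrow> real^'n^'n" where
  "transition A s 0 = mat 1"
| "transition A s (Suc k) = A (s + Suc k) ** transition A s k"

lemma transition_entry_Suc:
  "transition A s (Suc k) $ i $ j = (\<Sum>l\<in>UNIV. A (s + Suc k) $ i $ l * transition A s k $ l $ j)"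
  by (simp add: matrix_matrix_mult_def)

lemma row_stochastic_transition:
  "(\<And>t. s < t \<Longrightarrow> row_stochastic (A t)) \<Longrightarrow> row_stochastic (transition A s k)"
proof (induction k)
  case 0
  show ?case by (auto simp: row_stochastic_def mat_def)
qed (simp add: row_stochastic_mult)

lemma matrix_mult_sum_right:
  fixes A :: "real^'n^'k" shows "A ** (\<Sum>l\<in>I. v l) = (\<Sum>l\<in>I. A ** v l)"
  by (induction I rule: infinite_finite_induct) (auto simp: matrix_add_ldistrib)

text \<open>Variation of constants, with the initial value counted as input number 0. Input
  \<open>l\<close> enters at time \<open>s + l\<close> and passes through the remaining
  \<open>k - l\<close> matrices.\<close>

lemma transition_representation:
  fixes y v :: "nat \<Rightarrow> real^'m^'n"
  assumes "y 0 = v 0" and "\<And>k. y (Suc k) = A (s + Suc k) ** y k + v (Suc k)"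
  shows "y k = (\<Sum>l\<le>k. transition A (s + l) (k - l) ** v l)"
proof (induction k)
  case (Suc k)
  have "A (s + Suc k) ** transition A (s + l) (k - l) = transition A (s + l) (Suc k - l)" if "l \<le> k" for l
    using that by (simp add: Suc_diff_le)
  then have "A (s + Suc k) ** y k = (\<Sum>l\<le>k. transition A (s + l) (Suc k - l) ** v l)"
    unfolding Suc matrix_mult_sum_right by (intro sum.cong) (auto simp: matrix_mul_assoc)
  then show ?case using assms(2) by simp
qed (simp add: assms)

section \<open>Mean square decay of the transition matrices\<close>

context random_averaging
begin

abbreviation \<Phi> :: "nat \<Rightarrow> nat \<Rightarrow> 'w \<Rightarrow> real^'n^'n" where
  "\<Phi> s k \<omega> \<equiv> transition (\<lambda>t. W t \<omega>) s k"

text \<open>Column \<open>j\<close> starts as a unit vector at time \<open>s\<close>, hence with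
  values 0 and 1, and left multiplication averages it.\<close>

lemma transition_averaging_process:
  assumes "t0 \<le> s"
  shows "averaging_process M F W \<gamma> t0 B s (\<lambda>t \<omega> i. \<Phi> s (t - s) \<omega> $ i $ j)"
proof unfold_locales
  show "\<Phi> s (Suc t - s) \<omega> $ i $ j = (\<Sum>l\<in>UNIV. W (Suc t) \<omega> $ i $ l * \<Phi> s (t - s) \<omega> $ l $ j)"
    if "s \<le> t" for t \<omega> i
    using that transition_entry_Suc[of "\<lambda>t. W t \<omega>" s "t - s" i j] by (simp add: Suc_diff_le)
qed (use assms in \<open>auto simp: mat_def\<close>)

lemma column_osc_transition_measurable:
  assumes "t0 \<le> s"
  shows "(\<lambda>\<omega>. column_osc (\<Phi> s k \<omega>)) \<in> borel_measurable M"
proof -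
  have "(\<lambda>\<omega>. \<Phi> s k \<omega> $ i $ j) \<in> borel_measurable M" for i j
    using averaging_process.Z_measurable[OF transition_averaging_process[OF assms, of j], of "s + k" i] by simp
  then show ?thesis unfolding column_osc_def by (intro borel_measurable_sum borel_measurable_osc)
qed

lemma column_osc_transition_le:
  assumes "good \<omega>" "t0 \<le> s"
  shows "column_osc (\<Phi> s k \<omega>) \<le> real CARD('n)"
proof -
  have "osc (\<lambda>i. \<Phi> s k \<omega> $ i $ j) \<le> 1" for j
    using averaging_process.osc_Z_bounds[OF transition_averaging_process[OF assms(2), of j] assms(1), of "s + k"] by simp
  then have "(\<Sum>j\<in>UNIV. osc (\<lambda>i. \<Phi> s k \<omega> $ i $ j)) \<le> (\<Sum>j\<in>(UNIV::'n set). 1)" by (intro sum_mono) auto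
  then show ?thesis by (simp add: column_osc_def)
qed

lemma column_osc_transition_integrable:
  assumes "t0 \<le> s" shows "integrable M (\<lambda>\<omega>. (column_osc (\<Phi> s k \<omega>))\<^sup>2)"
proof (rule integrable_const_bound)
  show "AE \<omega> in M. norm ((column_osc (\<Phi> s k \<omega>))\<^sup>2) \<le> (real CARD('n))\<^sup>2"
    using AE_good by eventually_elim (auto intro!: power_mono column_osc_transition_le assms column_osc_nonneg)
  show "(\<lambda>\<omega>. (column_osc (\<Phi> s k \<omega>))\<^sup>2) \<in> borel_measurable M"
    using column_osc_transition_measurable[OF assms] by simp
qed

lemma expected_column_osc_decay:
  "\<exists>C r. 0 < C \<and> 0 < r \<and> r < 1 \<and>
    (\<forall>s\<ge>t0. \<forall>k. (\<integral>\<omega>. (column_osc (\<Phi> s k \<omega>))\<^sup>2 \<partial>M) \<le> C * (r ^ k)\<^sup>2)"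
proof -
  \<comment> \<open>The root turns the contraction per block into a factor per step; the exponent is
    doubled because the decay concerns a second moment.\<close>
  define r where "r = root (2 * B) (1 - rate)"
  define C where "C = 4 * real CARD('n) / r ^ (2 * ((t0 + 2) * B))"
  have r: "0 < r" "r < 1" "r ^ (2 * B) = 1 - rate"
    using rate_bounds B_pos by (auto simp: r_def real_root_gt_zero real_root_lt_1_iff)
  have C: "0 < C" using r by (simp add: C_def)
  have "(\<integral>\<omega>. (column_osc (\<Phi> s k \<omega>))\<^sup>2 \<partial>M) \<le> (real CARD('n))\<^sup>2 * C * (r ^ k)\<^sup>2" if s: "t0 \<le> s" for s k
  proof -
    let ?O = "\<lambda>j \<omega>. osc (\<lambda>i. \<Phi> s k \<omega> $ i $ j)"
    note proc = transition_averaging_process[OF s]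
    have int: "integrable M (\<lambda>\<omega>. (?O j \<omega>)\<^sup>2)" for j
      using averaging_process.osc_sq_integrable[OF proc[of j], of "s + k"] by simp
    have "(\<integral>\<omega>. (column_osc (\<Phi> s k \<omega>))\<^sup>2 \<partial>M) \<le> (\<integral>\<omega>. real CARD('n) * (\<Sum>j\<in>UNIV. (?O j \<omega>)\<^sup>2) \<partial>M)"
    proof (rule integral_mono)
      show "integrable M (\<lambda>\<omega>. (column_osc (\<Phi> s k \<omega>))\<^sup>2)" by (rule column_osc_transition_integrable[OF s])
      show "integrable M (\<lambda>\<omega>. real CARD('n) * (\<Sum>j\<in>UNIV. (?O j \<omega>)\<^sup>2))" using int by simp
      show "(column_osc (\<Phi> s k \<omega>))\<^sup>2 \<le> real CARD('n) * (\<Sum>j\<in>UNIV. (?O j \<omega>)\<^sup>2)" for \<omega>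
        \<comment> \<open>Cauchy-Schwarz over the columns costs one factor \<open>CARD('n)\<close>,
          and adding up the column bounds costs another.\<close>
        using Cauchy_Schwarz_ineq_sum[of "\<lambda>_. 1" "\<lambda>j. ?O j \<omega>" UNIV] by (simp add: column_osc_def)
    qed
    also have "\<dots> = real CARD('n) * (\<Sum>j\<in>UNIV. \<integral>\<omega>. (?O j \<omega>)\<^sup>2 \<partial>M)" using int by simp
    also have "\<dots> \<le> real CARD('n) * (\<Sum>j\<in>(UNIV::'n set). C * (r ^ k)\<^sup>2)"
      using averaging_process.expected_osc_sq_decay[OF proc r, of "s + k"]
      by (intro mult_left_mono sum_mono) (auto simp: C_def)
    finally show ?thesis by (simp add: power2_eq_square mult_ac)
  qed
  then show ?thesis using r C by (intro exI[of _ "(real CARD('n))\<^sup>2 * C"] exI[of _ r]) auto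
qed

end

section \<open>Deterministic estimates and continuity\<close>

lemma dominated_on_initial_segment:
  fixes f b :: "nat \<Rightarrow> real"
  assumes "\<And>k. 0 < b k"
  shows "\<exists>C\<ge>0. \<forall>k\<le>N. f k \<le> C * b k"
proof -
  define C where "C = (\<Sum>k\<le>N. \<bar>f k\<bar> / b k)"
  have "f k \<le> C * b k" if "k \<le> N" for k
  proof -
    have "\<bar>f k\<bar> / b k \<le> C" unfolding C_def
      by (rule member_le_sum[of k "{..N}" "\<lambda>k. \<bar>f k\<bar> / b k"]) (use that assms in \<open>auto intro!: divide_nonneg_pos\<close>)
    then show ?thesis using assms[of k] by (simp add: divide_le_eq)
  qed
  moreover have "0 \<le> C" unfolding C_def by (intro sum_nonneg divide_nonneg_pos assms) auto
  ultimately show ?thesis by blast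
qed

lemma geometric_convolution_bound:
  fixes b :: "nat \<Rightarrow> real"
  assumes b: "\<And>k. 0 < b k" and lim: "(\<lambda>k. b k / b (Suc k)) \<longlonglongrightarrow> 1"
    and r: "0 < r" "r < 1" and q: "0 \<le> q" and S: "\<And>k. S (Suc k) = r * S k + q * b k"
  shows "\<exists>C\<ge>0. \<forall>k. S k \<le> C * b k"
proof -
  \<comment> \<open>The midpoint of 1 and \<open>1 / r\<close>: above 1, so that the ratios of
    \<open>b\<close> eventually stay below it, yet with \<open>r * e < 1\<close>.\<close>
  define e where "e = (1 / r + 1) / 2"
  have e: "1 < e" "r * e < 1" using r by (simp_all add: e_def field_simps)
  have "\<forall>\<^sub>F k in sequentially. b k / b (Suc k) < e" using order_tendstoD(2)[OF lim e(1)] .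
  then obtain N where N: "\<And>k. N \<le> k \<Longrightarrow> b k / b (Suc k) < e" by (auto simp: eventually_sequentially)
  obtain C0 where C0: "0 \<le> C0" "\<And>k. k \<le> N \<Longrightarrow> S k \<le> C0 * b k"
    using dominated_on_initial_segment[of b N S] b by blast
  \<comment> \<open>Large enough for the initial segment and for
    \<open>(r * C + q) * e \<le> C\<close>, which makes the bound propagate by induction.\<close>
  define C where "C = max C0 (q * e / (1 - r * e))"
  have C: "0 \<le> C" "C0 \<le> C" "q * e / (1 - r * e) \<le> C" using C0 by (auto simp: C_def)
  then have Cq: "(r * C + q) * e \<le> C" using e by (simp add: divide_le_eq algebra_simps)
  have small: "S k \<le> C * b k" if "k \<le> N" for k
    using C0(2)[OF that] C(2) b[of k] by (meson mult_right_mono less_imp_le order_trans)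
  have "S k \<le> C * b k" if "N \<le> k" for k
    using that
  proof (induction k rule: dec_induct)
    case (step k)
    have "S (Suc k) \<le> (r * C + q) * b k" using step.IH r by (simp add: S algebra_simps)
    also have "\<dots> \<le> (r * C + q) * (e * b (Suc k))"
      using N[OF step.hyps(1)] b[of "Suc k"] r q C by (intro mult_left_mono) (auto simp: divide_less_eq)
    also have "\<dots> = (r * C + q) * e * b (Suc k)" by simp
    also have "\<dots> \<le> C * b (Suc k)" using Cq b[of "Suc k"] by (intro mult_right_mono) auto
    finally show ?case .
  qed (simp add: small)
  then show ?thesis using C small by (meson nat_le_linear)
qed

text \<open>Each term is split as \<open>sqrt (a l * p l)\<close> times
  \<open>sqrt (a l / p l) * Y l\<close>. If the second moment of \<open>Y l\<close> is of order
  \<open>(p l)^2\<close>, the expectation of the right side is of order the square of the sum of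
  \<open>a l * p l\<close>, as Minkowski's inequality would give.\<close>

lemma weighted_Cauchy_Schwarz:
  fixes a p Y :: "'i \<Rightarrow> real"
  assumes "\<And>l. l \<in> I \<Longrightarrow> 0 \<le> a l" "\<And>l. l \<in> I \<Longrightarrow> 0 < p l"
  shows "(\<Sum>l\<in>I. a l * Y l)\<^sup>2 \<le> (\<Sum>l\<in>I. a l * p l) * (\<Sum>l\<in>I. a l / p l * (Y l)\<^sup>2)"
proof -
  have "(\<Sum>l\<in>I. a l * Y l) = (\<Sum>l\<in>I. sqrt (a l * p l) * (sqrt (a l / p l) * Y l))"
  proof (intro sum.cong refl)
    fix l assume l: "l \<in> I"
    have "sqrt (a l * p l) * sqrt (a l / p l) = a l"
      using assms[OF l] by (simp flip: real_sqrt_mult)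
    then show "a l * Y l = sqrt (a l * p l) * (sqrt (a l / p l) * Y l)" by (simp flip: mult.assoc)
  qed
  also have "(\<dots>)\<^sup>2 \<le> (\<Sum>l\<in>I. (sqrt (a l * p l))\<^sup>2) * (\<Sum>l\<in>I. (sqrt (a l / p l) * Y l)\<^sup>2)"
    by (rule Cauchy_Schwarz_ineq_sum)
  also have "(\<Sum>l\<in>I. (sqrt (a l * p l))\<^sup>2) = (\<Sum>l\<in>I. a l * p l)"
    using assms by (intro sum.cong) (auto simp: less_imp_le)
  also have "(\<Sum>l\<in>I. (sqrt (a l / p l) * Y l)\<^sup>2) = (\<Sum>l\<in>I. a l / p l * (Y l)\<^sup>2)"
    using assms by (intro sum.cong) (auto simp: power_mult_distrib less_imp_le)
  finally show ?thesis .
qed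

lemma continuous_on_matrix_mult:
  fixes f :: "'a::topological_space \<Rightarrow> real^'k^'n" and g :: "'a \<Rightarrow> real^'m^'k"
  assumes "continuous_on T f" "continuous_on T g"
  shows "continuous_on T (\<lambda>x. f x ** g x)"
  unfolding matrix_matrix_mult_def by (intro continuous_intros assms)

lemma continuous_on_spread: "continuous_on UNIV (spread :: real^'m^'n \<Rightarrow> real)"
proof -
  have "continuous_on UNIV (\<lambda>x::real^'m^'n. Max ((\<lambda>p. infnorm (x $ fst p - x $ snd p)) ` P))" if "finite P" "P \<noteq> {}" for P
    using that by (induction P rule: finite_ne_induct) (auto intro!: continuous_intros)
  then show ?thesis unfolding spread_eq_Max case_prod_unfold by simp
qed

section \<open>The second moment of the perturbed process\<close>

theorem lemma8:
  fixes M :: "'w measure"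
    and F :: "nat \<Rightarrow> 'w measure"
    and W :: "nat \<Rightarrow> 'w \<Rightarrow> real^'n^'n"
    and u x :: "nat \<Rightarrow> 'w \<Rightarrow> real^'m^'n"
    and x0 :: "real^'m^'n"
    and \<alpha> :: "nat \<Rightarrow> real"
    and \<gamma> K \<beta> q :: real
    and t0 B :: nat
  assumes "prob_space M"
    and "filtration (space M) F"
    and "\<And>t. subalgebra M (F t)"
    and "\<And>t. W t \<in> borel_measurable (F t)"
    and "\<And>t. t \<ge> t0 \<Longrightarrow> AE \<omega> in M. row_stochastic (W t \<omega>)"
    and "\<And>t. t > t0 \<Longrightarrow> AE \<omega> in M. column_stochastic (cond_exp_matrix M (F (t - 1)) (W t) \<omega>)"
    and "0 < \<gamma>" and "\<gamma> < 1"
    and "\<And>t. t \<ge> t0 \<Longrightarrow> AE \<omega> in M. \<forall>i. (i, i) \<in> edges \<gamma> (W t \<omega>)"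
    and "B > 0"
    and "\<And>t. t \<ge> t0 \<Longrightarrow> AE \<omega> in M. has_spanning_rooted_tree
           (\<Union>\<tau>\<in>{t * B + 1..(t + 1) * B}. edges \<gamma> (cond_exp_matrix M (F (t * B)) (W \<tau>) \<omega>))"
    and "K > 0" and "\<beta> > 0"
    and "\<And>t. t \<ge> t0 \<Longrightarrow> 0 < \<alpha> t"
    and "\<And>t. t \<ge> t0 \<Longrightarrow> t > 0 \<Longrightarrow> \<alpha> t \<le> K * real t powr (- \<beta>)"
    and "(\<lambda>t. \<alpha> t / \<alpha> (t + 1)) \<longlonglongrightarrow> 1"
    and "filterlim (\<lambda>T. \<Sum>t=t0..T. \<alpha> t) at_top sequentially"
    and "summable (\<lambda>k. (\<alpha> (t0 + k))\<^sup>2)"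
    and "\<And>t. t \<ge> t0 \<Longrightarrow> u t \<in> borel_measurable M"
    and "\<And>\<omega>. \<omega> \<in> space M \<Longrightarrow> x t0 \<omega> = x0"
    and "\<And>t \<omega>. t \<ge> t0 \<Longrightarrow> \<omega> \<in> space M \<Longrightarrow> x (t + 1) \<omega> = W (t + 1) \<omega> ** x t \<omega> + u t \<omega>"
    and "q > 0"
    and "\<And>t. t \<ge> t0 \<Longrightarrow> AE \<omega> in M. spread (u t \<omega>) < q * \<alpha> t"
  shows "\<exists>Mhat>0. \<forall>t\<ge>t0. integrable M (\<lambda>\<omega>. (spread (x t \<omega>))\<^sup>2) \<and>
           prob_space.expectation M (\<lambda>\<omega>. (spread (x t \<omega>))\<^sup>2) / (\<alpha> t)\<^sup>2 \<le> Mhat"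
proof -
  interpret random_averaging M F W \<gamma> t0 B
  proof (intro random_averaging.intro random_averaging_axioms.intro)
    show "AE \<omega> in M. column_stochastic (cond_exp_matrix M (F t) (W (Suc t)) \<omega>)" if "t0 \<le> t" for t
      using assms(6)[of "Suc t"] that by simp
  qed (use assms in auto)
  \<comment> \<open>The inputs in the form of \<open>transition_representation\<close>:
    \<open>x0\<close> has index 0, and \<open>u (t0 + l)\<close> is shifted to index
    \<open>Suc l\<close>. The sequence \<open>a\<close> bounds their spreads
    deterministically.\<close>
  define v where "v \<omega> l = (case l of 0 \<Rightarrow> x0 | Suc l \<Rightarrow> u (t0 + l) \<omega>)" for \<omega> l
  define a where "a l = (case l of 0 \<Rightarrow> spread x0 | Suc l \<Rightarrow> q * \<alpha> (t0 + l))" for l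
  define b where "b k = \<alpha> (t0 + k)" for k
  obtain C r where C: "0 < C" and r: "0 < r" "r < 1"
    and decay: "\<And>s k. t0 \<le> s \<Longrightarrow> (\<integral>\<omega>. (column_osc (\<Phi> s k \<omega>))\<^sup>2 \<partial>M) \<le> C * (r ^ k)\<^sup>2"
    using expected_column_osc_decay by blast
  \<comment> \<open>The convolution of the input bounds with the geometric decay; it obeys the
    recursion of \<open>geometric_convolution_bound\<close>.\<close>
  define S where "S k = (\<Sum>l\<le>k. a l * r ^ (k - l))" for k
  have b: "0 < b k" for k using assms(14) by (simp add: b_def)
  have a: "0 \<le> a l" for l
    using assms(14)[of "t0 + (l - 1)"] \<open>q > 0\<close> by (auto simp: a_def spread_nonneg split: nat.split)
  have S_nonneg: "0 \<le> S k" for k unfolding S_def using a r by (intro sum_nonneg) auto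
  have S_Suc: "S (Suc k) = r * S k + q * b k" for k
  proof -
    have "(\<Sum>l\<le>k. a l * r ^ (Suc k - l)) = r * S k"
      unfolding S_def sum_distrib_left by (intro sum.cong) (auto simp: Suc_diff_le)
    then show ?thesis unfolding S_def[of "Suc k"] by (simp add: a_def b_def)
  qed
  have "(\<lambda>k. \<alpha> (k + t0) / \<alpha> (k + t0 + 1)) \<longlonglongrightarrow> 1" using LIMSEQ_ignore_initial_segment[OF assms(16)] .
  then have "(\<lambda>k. b k / b (Suc k)) \<longlonglongrightarrow> 1" by (simp add: b_def add.commute)
  from geometric_convolution_bound[of b, OF b this r _ S_Suc] \<open>q > 0\<close>
  obtain D where D: "0 \<le> D" "\<And>k. S k \<le> D * b k" by auto
  have repr: "x (t0 + k) \<omega> = (\<Sum>l\<le>k. \<Phi> (t0 + l) (k - l) \<omega> ** v \<omega> l)" if "\<omega> \<in> space M" for \<omega> k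
    using transition_representation[of "\<lambda>k. x (t0 + k) \<omega>" "v \<omega>" "\<lambda>t. W t \<omega>" t0 k] assms(20,21) that
    by (simp add: v_def)
  have AE_v: "AE \<omega> in M. \<forall>l. spread (v \<omega> l) \<le> a l"
    unfolding AE_all_countable
  proof
    fix l show "AE \<omega> in M. spread (v \<omega> l) \<le> a l"
    proof (cases l)
      case (Suc l')
      show ?thesis using assms(23)[of "t0 + l'"] by (auto simp: Suc v_def a_def elim: eventually_mono)
    qed (simp add: v_def a_def)
  qed
  have x_measurable: "x (t0 + k) \<in> borel_measurable M" for k
  proof (induction k)
    case 0
    have "x t0 \<in> borel_measurable M \<longleftrightarrow> (\<lambda>_. x0) \<in> borel_measurable M"
      using assms(20) by (intro measurable_cong)
    then show ?case by simp
  next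
    case (Suc k)
    have "(\<lambda>\<omega>. W (t0 + k + 1) \<omega> ** x (t0 + k) \<omega>) \<in> borel_measurable M"
      by (rule borel_measurable_continuous_Pair[OF F_imp_M[OF W_measurable] Suc])
        (intro continuous_on_matrix_mult continuous_intros)
    then have "(\<lambda>\<omega>. W (t0 + k + 1) \<omega> ** x (t0 + k) \<omega> + u (t0 + k) \<omega>) \<in> borel_measurable M"
      using assms(19)[of "t0 + k"] by simp
    moreover have "x (t0 + Suc k) \<in> borel_measurable M \<longleftrightarrow>
        (\<lambda>\<omega>. W (t0 + k + 1) \<omega> ** x (t0 + k) \<omega> + u (t0 + k) \<omega>) \<in> borel_measurable M"
      using assms(21)[of "t0 + k"] by (intro measurable_cong) simp
    ultimately show ?case by simp
  qed
  \<comment> \<open>The right side of \<open>weighted_Cauchy_Schwarz\<close> with weights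
    \<open>p l = r ^ (k - l)\<close>. The inputs enter only through the constants
    \<open>a l\<close>, so taking expectations leaves just the transition matrices.\<close>
  define G where "G k \<omega> = S k * (\<Sum>l\<le>k. a l / r ^ (k - l) * (column_osc (\<Phi> (t0 + l) (k - l) \<omega>))\<^sup>2)" for k \<omega>
  have spread_le: "AE \<omega> in M. (spread (x (t0 + k) \<omega>))\<^sup>2 \<le> G k \<omega>" for k
    using AE_good AE_v
  proof eventually_elim
    case (elim \<omega>)
    have "\<omega> \<in> space M" using elim(1) by (simp add: good_def)
    have "spread (x (t0 + k) \<omega>) \<le> (\<Sum>l\<le>k. spread (\<Phi> (t0 + l) (k - l) \<omega> ** v \<omega> l))"
      unfolding repr[OF \<open>\<omega> \<in> space M\<close>] by (rule spread_sum_le) simp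
    also have "\<dots> \<le> (\<Sum>l\<le>k. a l * column_osc (\<Phi> (t0 + l) (k - l) \<omega>))"
    proof (intro sum_mono)
      fix l
      have "spread (\<Phi> (t0 + l) (k - l) \<omega> ** v \<omega> l) \<le> column_osc (\<Phi> (t0 + l) (k - l) \<omega>) * spread (v \<omega> l)"
        by (intro spread_mult_le row_stochastic_transition good_row[OF elim(1)]) simp
      also have "\<dots> \<le> column_osc (\<Phi> (t0 + l) (k - l) \<omega>) * a l"
        using elim(2) by (intro mult_left_mono column_osc_nonneg) auto
      finally show "spread (\<Phi> (t0 + l) (k - l) \<omega> ** v \<omega> l) \<le> a l * column_osc (\<Phi> (t0 + l) (k - l) \<omega>)"
        by (simp only: mult.commute)
    qed
    finally have "(spread (x (t0 + k) \<omega>))\<^sup>2 \<le> (\<Sum>l\<le>k. a l * column_osc (\<Phi> (t0 + l) (k - l) \<omega>))\<^sup>2"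
      by (rule power_mono) (rule spread_nonneg)
    also have "\<dots> \<le> G k \<omega>"
      unfolding G_def S_def using a r by (intro weighted_Cauchy_Schwarz) auto
    finally show ?case .
  qed
  have G_integrable: "integrable M (G k)" for k
    unfolding G_def by (simp add: column_osc_transition_integrable)
  have spread_integrable: "integrable M (\<lambda>\<omega>. (spread (x (t0 + k) \<omega>))\<^sup>2)" for k
  proof (rule Bochner_Integration.integrable_bound[OF G_integrable])
    have "spread \<in> borel_measurable (borel :: (real^'m^'n) measure)"
      by (intro borel_measurable_continuous_onI continuous_on_spread)
    from measurable_compose[OF x_measurable this]
    show "(\<lambda>\<omega>. (spread (x (t0 + k) \<omega>))\<^sup>2) \<in> borel_measurable M" by simp
    show "AE \<omega> in M. norm ((spread (x (t0 + k) \<omega>))\<^sup>2) \<le> norm (G k \<omega>)"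
      using spread_le[of k] by eventually_elim simp
  qed
  have sq_bound: "expectation (\<lambda>\<omega>. (spread (x (t0 + k) \<omega>))\<^sup>2) \<le> C * D\<^sup>2 * (\<alpha> (t0 + k))\<^sup>2" for k
  proof -
    have "expectation (\<lambda>\<omega>. (spread (x (t0 + k) \<omega>))\<^sup>2) \<le> expectation (G k)"
      by (intro integral_mono_AE spread_integrable G_integrable spread_le)
    also have "\<dots> = S k * (\<Sum>l\<le>k. a l / r ^ (k - l) * expectation (\<lambda>\<omega>. (column_osc (\<Phi> (t0 + l) (k - l) \<omega>))\<^sup>2))"
      unfolding G_def by (simp add: column_osc_transition_integrable)
    also have "\<dots> \<le> S k * (\<Sum>l\<le>k. a l / r ^ (k - l) * (C * (r ^ (k - l))\<^sup>2))"
      using a r S_nonneg by (intro mult_left_mono sum_mono decay) auto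
    \<comment> \<open>One power of \<open>r\<close> cancels against the weight, so the second factor
      is again a multiple of \<open>S k\<close>.\<close>
    also have "(\<Sum>l\<le>k. a l / r ^ (k - l) * (C * (r ^ (k - l))\<^sup>2)) = C * S k"
      unfolding S_def sum_distrib_left using r by (intro sum.cong) (auto simp: power2_eq_square)
    also have "S k * (C * S k) = C * (S k)\<^sup>2" by (simp add: power2_eq_square)
    also have "\<dots> \<le> C * (D * b k)\<^sup>2"
      using C D S_nonneg by (intro mult_left_mono power_mono) auto
    finally show ?thesis by (simp add: power_mult_distrib b_def)
  qed
  have bound: "expectation (\<lambda>\<omega>. (spread (x (t0 + k) \<omega>))\<^sup>2) / (\<alpha> (t0 + k))\<^sup>2 \<le> C * D\<^sup>2 + 1" for k
  proof -
    have "expectation (\<lambda>\<omega>. (spread (x (t0 + k) \<omega>))\<^sup>2) / (\<alpha> (t0 + k))\<^sup>2 \<le> C * D\<^sup>2"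
      using b[of k] sq_bound[of k] by (simp add: b_def pos_divide_le_eq)
    then show ?thesis by simp
  qed
  show ?thesis
  \<comment> \<open>Adding 1 keeps the constant positive even if \<open>D\<close> is 0.\<close>
  proof (intro exI[of _ "C * D\<^sup>2 + 1"] conjI allI impI)
    show "0 < C * D\<^sup>2 + 1" using C by (simp add: add_nonneg_pos)
    fix t assume "t0 \<le> t"
    then obtain k where "t = t0 + k" using le_Suc_ex by blast
    then show "integrable M (\<lambda>\<omega>. (spread (x t \<omega>))\<^sup>2)"
      "expectation (\<lambda>\<omega>. (spread (x t \<omega>))\<^sup>2) / (\<alpha> t)\<^sup>2 \<le> C * D\<^sup>2 + 1"
      using spread_integrable bound by auto
  qed
qed

end
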